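(* Let $A\to M$ be a Lie algebroid, $p\colon\overline{M}\to M$ a fiber bundle, and $\overline{A}$ the $p$-prolongation Lie algebroid of $A$, described in local coordinates and local bases as in the context. Let $\sigma^k=\theta^k_\alpha\bar e^\alpha+\varpi^k_\mu\overline{E}^\mu\in\Lambda^1(\overline{A})$, $k=1,\dots,n$, where $\theta^k_\alpha,\varpi^k_\mu$ are smooth functions of $(x,y)$. Suppose that the algebraic ideal $\mathcal{I}=\langle\sigma^1,\dots,\sigma^n\rangle_{\mathrm{alg}}$ generated by these forms is a differential ideal. Then for every solution $\bar y^\mu(x)$ of the system of PDEs $$\theta^k_\alpha(x,\bar y)+\rho^i_\alpha\frac{\partial\bar y^\mu}{\partial x^i}\varpi^k_\mu(x,\bar y)=0\qquad(\text{all }k,\alpha),$$ the dependency condition $$0=-Y_\alpha(\theta^k_\beta)-X_\beta(\bar y^\mu)Y_\alpha(\varpi^k_\mu)+Y_\beta(\theta^k_\alpha)+X_\alpha(\bar y^\mu)Y_\beta(\varpi^k_\mu)+L^\gamma_{\alpha\beta}\theta^k_\gamma$$ holds identically (for all $k,\alpha,\beta$, evaluated at $y=\bar y(x)$), where $X_\alpha=\rho^i_\alpha\frac{\partial}{\partial x^i}$ and $Y_\alpha=X_\alpha+X_\alpha(\bar y^\nu)\frac{\partial}{\partial y^\nu}$.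
   Context: Summation over repeated indices is used. A Lie algebroid $(A,\llbracket\cdot,\cdot\rrbracket,\rho)$ over $M$ is a vector bundle $A\to M$ with an anchor $\rho\colon A\to\mathrm{T}M$ (linear bundle map) and a Lie bracket on $\Gamma(A)$ with $\llbracket\sigma_1,f\sigma_2\rrbracket=\rho(\sigma_1)(f)\sigma_2+f\llbracket\sigma_1,\sigma_2\rrbracket$. Locally, with coordinates $x^i$ on $M$ and a local basis $\{e_\alpha\}$ of $\Gamma(A)$, $\rho(e_\alpha)=\rho^i_\alpha(x)\frac{\partial}{\partial x^i}$ and $\llbracket e_\alpha,e_\beta\rrbracket=L^\gamma_{\alpha\beta}(x)e_\gamma$; one has $[X_\alpha,X_\beta]=L_{\alpha\beta}^\gamma X_\gamma$ for $X_\alpha=\rho^i_\alpha\partial/\partial x^i$. Let $p\colon\overline{M}\to M$ be given locally by $(x^i,y^\mu)\mapsto(x^i)$. The $p$-prolongation Lie algebroid is $\overline{A}=\{(a_m,\bar v_{\bar m})\in A\times\mathrm{T}\overline{M}\mid\rho(a_m)=\mathrm{T}p(\bar v_{\bar m})\}\to\overline{M}$, with anchor $\bar\rho(a_m,\bar v_{\bar m})=\bar v_{\bar m}$, and bracket determined by $\llbracket(\sigma_1,X_1),(\sigma_2,X_2)\rrbracket=(\llbracket\sigma_1,\sigma_2\rrbracket^A,[X_1,X_2])$ on projectable sections (those with $\sigma_i\in\Gamma(A)$) and the Leibniz rule. A local basis of $\Gamma(\overline{A})$ is $\bar e_\alpha=(e_\alpha,\rho^i_\alpha\frac{\partial}{\partial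 x^i})$, $\overline{E}_\mu=(0,\frac{\partial}{\partial y^\mu})$, with dual basis $\{\bar e^\alpha,\overline{E}^\mu\}$. $\Lambda^q(\overline A)$ denotes $q$-forms, i.e. sections of the $q$-th exterior power of the dual bundle, and $\Lambda^*(\overline{A})$ all forms. The Lie algebroid exterior derivative $\delta$ on $\overline{A}$ is the degree one derivation determined by $\delta\bar f=\rho^i_\alpha\frac{\partial\bar f}{\partial x^i}\bar e^\alpha+\frac{\partial\bar f}{\partial y^\mu}\overline{E}^\mu$, $\delta\bar e^\alpha=-\frac12L^\alpha_{\beta\gamma}\bar e^\beta\wedge\bar e^\gamma$, $\delta\overline{E}^\mu=0$ and $\delta(\omega\wedge\theta)=\delta\omega\wedge\theta+(-1)^q\omega\wedge\delta\theta$ for $\omega$ of degree $q$. $\langle\sigma^1,\dots,\sigma^n\rangle_{\mathrm{alg}}=\{\alpha_k\wedge\sigma^k\mid\alpha_k\in\Lambda^*(\overline{A})\}$; it is a differential ideal if it is closed under $\delta$. *)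

theory Defs
  imports "HOL-Analysis.Analysis"
begin

primrec Ck_on :: "nat \<Rightarrow> 'a::real_normed_vector set \<Rightarrow> ('a \<Rightarrow> 'b::real_normed_vector) \<Rightarrow> bool" where
  "Ck_on 0 S f \<longleftrightarrow> continuous_on S f"
| "Ck_on (Suc k) S f \<longleftrightarrow>
     (\<forall>x\<in>S. f differentiable (at x)) \<and> (\<forall>v. Ck_on k S (\<lambda>x. frechet_derivative f (at x) v))"

(* Meant for open S; the values of f outside S are then irrelevant. *)
definition smooth_on :: "'a::real_normed_vector set \<Rightarrow> ('a \<Rightarrow> 'b::real_normed_vector) \<Rightarrow> bool" where
  "smooth_on S f \<longleftrightarrow> (\<forall>k. Ck_on k S f)"


section \<open>Lie algebroids over a coordinate domain\<close>

text \<open>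
  A coordinate domain of \<open>M\<close> over which \<open>A\<close> has a basis of sections is an open
  set \<open>U \<subseteq> \<real>\<^sup>m\<close>, and \<open>A\<close> over it is \<open>U \<times> \<real>\<^sup>a\<close>.  Sections over \<open>U\<close> are represented by total
  functions that vanish outside \<open>U\<close>, so that equality of sections is equality of functions.
\<close>

definition lie_sections :: "(real^'m) set \<Rightarrow> (real^'m \<Rightarrow> real^'a) set" where
  "lie_sections U = {s. smooth_on U s \<and> (\<forall>x. x \<notin> U \<longrightarrow> s x = 0)}"

locale lie_algebroid =
  fixes U :: "(real^'m) set"
    and \<rho> :: "real^'m \<Rightarrow> real^'a \<Rightarrow> real^'m"
    and br :: "(real^'m \<Rightarrow> real^'a) \<Rightarrow> (real^'m \<Rightarrow> real^'a) \<Rightarrow> (real^'m \<Rightarrow> real^'a)"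
  assumes open_base: "open U"
    and anchor_linear: "x \<in> U \<Longrightarrow> linear (\<rho> x)"
    and anchor_smooth: "smooth_on U (\<lambda>x. \<rho> x a)"
    and br_closed: "\<lbrakk>s \<in> lie_sections U; t \<in> lie_sections U\<rbrakk> \<Longrightarrow> br s t \<in> lie_sections U"
    and br_linear: "\<lbrakk>r \<in> lie_sections U; s \<in> lie_sections U; t \<in> lie_sections U\<rbrakk>
      \<Longrightarrow> br r (\<lambda>x. c *\<^sub>R s x + t x) = (\<lambda>x. c *\<^sub>R br r s x + br r t x)"
    and br_antisym: "\<lbrakk>s \<in> lie_sections U; t \<in> lie_sections U\<rbrakk> \<Longrightarrow> br t s = (\<lambda>x. - br s t x)"
    and br_jacobi: "\<lbrakk>r \<in> lie_sections U; s \<in> lie_sections U; t \<in> lie_sections U\<rbrakk>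
      \<Longrightarrow> br r (br s t) x + br s (br t r) x + br t (br r s) x = 0"
    and br_leibniz: "\<lbrakk>s \<in> lie_sections U; t \<in> lie_sections U; smooth_on U f\<rbrakk>
      \<Longrightarrow> br s (\<lambda>x. f x *\<^sub>R t x) =
          (\<lambda>x. frechet_derivative f (at x) (\<rho> x (s x)) *\<^sub>R t x + f x *\<^sub>R br s t x)"

definition basis_section :: "(real^'m) set \<Rightarrow> 'a \<Rightarrow> real^'m \<Rightarrow> real^'a" where
  "basis_section U \<alpha> x = (if x \<in> U then axis \<alpha> 1 else 0)"

(* anchor_coeff rho i alpha  is  rho^i_alpha *)
definition anchor_coeff :: "(real^'m \<Rightarrow> real^'a \<Rightarrow> real^'m) \<Rightarrow> 'm \<Rightarrow> 'a \<Rightarrow> real^'m \<Rightarrow> real" where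
  "anchor_coeff \<rho> i \<alpha> x = \<rho> x (axis \<alpha> 1) $ i"

(* bracket_coeff U br gamma alpha beta  is  L^gamma_{alpha beta} *)
definition bracket_coeff ::
  "(real^'m) set \<Rightarrow> ((real^'m \<Rightarrow> real^'a) \<Rightarrow> (real^'m \<Rightarrow> real^'a) \<Rightarrow> (real^'m \<Rightarrow> real^'a))
    \<Rightarrow> 'a \<Rightarrow> 'a \<Rightarrow> 'a \<Rightarrow> real^'m \<Rightarrow> real" where
  "bracket_coeff U br \<gamma> \<alpha> \<beta> x = br (basis_section U \<alpha>) (basis_section U \<beta>) x $ \<gamma>"


section \<open>The prolongation bundle and its forms\<close>

text \<open>
  A fibred chart of \<open>p\<close> identifies an open part of the total space with an open
  \<open>W \<subseteq> \<real>\<^sup>m \<times> \<real>\<^sup>r\<close> on which \<open>p\<close> is the first projection, and \<open>Tp\<close> is then the first projection on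
  tangent vectors.
\<close>

type_synonym ('a, 'm, 'r) pvec = "(real^'a) \<times> (real^'m) \<times> (real^'r)"

definition prolongation_fibre ::
  "(real^'m \<Rightarrow> real^'a \<Rightarrow> real^'m) \<Rightarrow> (real^'m) \<times> (real^'r) \<Rightarrow> ('a, 'm, 'r) pvec set" where
  "prolongation_fibre \<rho> p = {(a, v). \<rho> (fst p) a = fst v}"

(* The element  a^alpha e_alpha + w^mu E_mu  of the fibre over p, in the local basis
   e_alpha = (e_alpha, rho^i_alpha d/dx^i),  E_mu = (0, d/dy^mu). *)
definition prolongation_elem ::
  "(real^'m \<Rightarrow> real^'a \<Rightarrow> real^'m) \<Rightarrow> (real^'m) \<times> (real^'r) \<Rightarrow> (real^'a) \<times> (real^'r)
    \<Rightarrow> ('a, 'm, 'r) pvec" where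
  "prolongation_elem \<rho> p c = (fst c, \<rho> (fst p) (fst c), snd c)"

text \<open>
  A form of mixed degree assigns to each point \<open>p\<close> an alternating multilinear function of lists of
  vectors in the fibre over \<open>p\<close>; its part of degree \<open>q\<close> is the restriction to lists of length \<open>q\<close>.
  Again everything is set to \<open>0\<close> where it is not meaningful.
\<close>

type_synonym ('a, 'm, 'r) form = "(real^'m) \<times> (real^'r) \<Rightarrow> ('a, 'm, 'r) pvec list \<Rightarrow> real"

definition alternating_multilinear_on :: "'v::real_vector set \<Rightarrow> ('v list \<Rightarrow> real) \<Rightarrow> bool" where
  "alternating_multilinear_on F \<phi> \<longleftrightarrow>
     (\<forall>us v w vs c. set us \<subseteq> F \<and> v \<in> F \<and> w \<in> F \<and> set vs \<subseteq> F \<longrightarrow>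
        \<phi> (us @ (c *\<^sub>R v + w) # vs) = c * \<phi> (us @ v # vs) + \<phi> (us @ w # vs)) \<and>
     (\<forall>vs. set vs \<subseteq> F \<and> \<not> distinct vs \<longrightarrow> \<phi> vs = 0)"

(* Smoothness: all values on sections with constant coefficients in the local basis are smooth
   functions; by multilinearity these are determined by the values on the basis sections. *)
definition forms ::
  "(real^'m \<Rightarrow> real^'a \<Rightarrow> real^'m) \<Rightarrow> ((real^'m) \<times> (real^'r)) set \<Rightarrow> ('a, 'm, 'r) form set" where
  "forms \<rho> W = {\<omega>.
     (\<forall>p\<in>W. alternating_multilinear_on (prolongation_fibre \<rho> p) (\<omega> p)) \<and>
     (\<forall>cs. smooth_on W (\<lambda>p. \<omega> p (map (prolongation_elem \<rho> p) cs))) \<and>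
     (\<forall>p vs. p \<notin> W \<or> \<not> set vs \<subseteq> prolongation_fibre \<rho> p \<longrightarrow> \<omega> p vs = 0)}"

definition forms_of_degree ::
  "nat \<Rightarrow> (real^'m \<Rightarrow> real^'a \<Rightarrow> real^'m) \<Rightarrow> ((real^'m) \<times> (real^'r)) set
    \<Rightarrow> ('a, 'm, 'r) form set" where
  "forms_of_degree q \<rho> W = {\<omega> \<in> forms \<rho> W. \<forall>p vs. length vs \<noteq> q \<longrightarrow> \<omega> p vs = 0}"

(* The sign of the shuffle that moves the positions in S in front of the other positions < n. *)
definition shuffle_sign :: "nat \<Rightarrow> nat set \<Rightarrow> real" where
  "shuffle_sign n S = (- 1) ^ card {(i, j). i < j \<and> j < n \<and> i \<notin> S \<and> j \<in> S}"

(* Normalised without factorials:  (a \<and> b)(v, w) = a(v) b(w) - a(w) b(v)  for one-forms. *)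
definition wedge ::
  "('a, 'm, 'r) form \<Rightarrow> ('a, 'm, 'r) form \<Rightarrow> ('a, 'm, 'r) form" (infixr "\<^bold>\<and>" 70) where
  "(\<omega> \<^bold>\<and> \<eta>) p vs =
     (\<Sum>S\<in>Pow {..<length vs}. shuffle_sign (length vs) S * \<omega> p (nths vs S) * \<eta> p (nths vs (- S)))"

definition fun_form ::
  "((real^'m) \<times> (real^'r)) set \<Rightarrow> ((real^'m) \<times> (real^'r) \<Rightarrow> real) \<Rightarrow> ('a, 'm, 'r) form" where
  "fun_form W f p vs = (if p \<in> W \<and> vs = [] then f p else 0)"

(* The dual basis. *)
definition coframe_e ::
  "(real^'m \<Rightarrow> real^'a \<Rightarrow> real^'m) \<Rightarrow> ((real^'m) \<times> (real^'r)) set \<Rightarrow> 'a \<Rightarrow> ('a, 'm, 'r) form" where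
  "coframe_e \<rho> W \<alpha> p vs =
     (if p \<in> W \<and> length vs = 1 \<and> set vs \<subseteq> prolongation_fibre \<rho> p then fst (hd vs) $ \<alpha> else 0)"

definition coframe_E ::
  "(real^'m \<Rightarrow> real^'a \<Rightarrow> real^'m) \<Rightarrow> ((real^'m) \<times> (real^'r)) set \<Rightarrow> 'r \<Rightarrow> ('a, 'm, 'r) form" where
  "coframe_E \<rho> W \<mu> p vs =
     (if p \<in> W \<and> length vs = 1 \<and> set vs \<subseteq> prolongation_fibre \<rho> p
      then snd (snd (hd vs)) $ \<mu> else 0)"

(* The one-form  theta_alpha e^alpha + varpi_mu E^mu. *)
definition one_form ::
  "(real^'m \<Rightarrow> real^'a \<Rightarrow> real^'m) \<Rightarrow> ((real^'m) \<times> (real^'r)) set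
    \<Rightarrow> ('a \<Rightarrow> (real^'m) \<times> (real^'r) \<Rightarrow> real) \<Rightarrow> ('r \<Rightarrow> (real^'m) \<times> (real^'r) \<Rightarrow> real)
    \<Rightarrow> ('a, 'm, 'r) form" where
  "one_form \<rho> W \<theta> varpi p vs =
     (\<Sum>\<alpha>\<in>UNIV. \<theta> \<alpha> p * coframe_e \<rho> W \<alpha> p vs) + (\<Sum>\<mu>\<in>UNIV. varpi \<mu> p * coframe_E \<rho> W \<mu> p vs)"


section \<open>The exterior derivative and differential ideals\<close>

definition partial_x :: "'m \<Rightarrow> ((real^'m) \<times> (real^'r) \<Rightarrow> real) \<Rightarrow> (real^'m) \<times> (real^'r) \<Rightarrow> real" where
  "partial_x i f p = frechet_derivative f (at p) (axis i 1, 0)"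

definition partial_y :: "'r \<Rightarrow> ((real^'m) \<times> (real^'r) \<Rightarrow> real) \<Rightarrow> (real^'m) \<times> (real^'r) \<Rightarrow> real" where
  "partial_y \<mu> f p = frechet_derivative f (at p) (0, axis \<mu> 1)"

definition exterior_derivative ::
  "(real^'m) set \<Rightarrow> (real^'m \<Rightarrow> real^'a \<Rightarrow> real^'m)
    \<Rightarrow> ((real^'m \<Rightarrow> real^'a) \<Rightarrow> (real^'m \<Rightarrow> real^'a) \<Rightarrow> (real^'m \<Rightarrow> real^'a))
    \<Rightarrow> ((real^'m) \<times> (real^'r)) set \<Rightarrow> (('a, 'm, 'r) form \<Rightarrow> ('a, 'm, 'r) form) \<Rightarrow> bool" where
  "exterior_derivative U \<rho> br W \<delta> \<longleftrightarrow>
     (\<forall>q. \<forall>\<omega>\<in>forms_of_degree q \<rho> W. \<delta> \<omega> \<in> forms_of_degree (Suc q) \<rho> W) \<and>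
     (\<forall>\<omega>\<in>forms \<rho> W. \<forall>\<eta>\<in>forms \<rho> W. \<forall>c.
        \<delta> (\<lambda>p vs. c * \<omega> p vs + \<eta> p vs) = (\<lambda>p vs. c * \<delta> \<omega> p vs + \<delta> \<eta> p vs)) \<and>
     (\<forall>q. \<forall>\<omega>\<in>forms_of_degree q \<rho> W. \<forall>\<eta>\<in>forms \<rho> W.
        \<delta> (\<omega> \<^bold>\<and> \<eta>) = (\<lambda>p vs. (\<delta> \<omega> \<^bold>\<and> \<eta>) p vs + (- 1) ^ q * (\<omega> \<^bold>\<and> \<delta> \<eta>) p vs)) \<and>
     (\<forall>f. smooth_on W f \<longrightarrow>
        \<delta> (fun_form W f) =
          one_form \<rho> W (\<lambda>\<alpha> p. \<Sum>i\<in>UNIV. anchor_coeff \<rho> i \<alpha> (fst p) * partial_x i f p)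
                       (\<lambda>\<mu>. partial_y \<mu> f)) \<and>
     (\<forall>\<alpha>. \<delta> (coframe_e \<rho> W \<alpha>) =
        (\<lambda>p vs. - (1 / 2) * (\<Sum>\<beta>\<in>UNIV. \<Sum>\<gamma>\<in>UNIV. bracket_coeff U br \<alpha> \<beta> \<gamma> (fst p) *
                   (coframe_e \<rho> W \<beta> \<^bold>\<and> coframe_e \<rho> W \<gamma>) p vs))) \<and>
     (\<forall>\<mu>. \<delta> (coframe_E \<rho> W \<mu>) = (\<lambda>p vs. 0))"

definition algebraic_ideal ::
  "(real^'m \<Rightarrow> real^'a \<Rightarrow> real^'m) \<Rightarrow> ((real^'m) \<times> (real^'r)) set \<Rightarrow> nat
    \<Rightarrow> (nat \<Rightarrow> ('a, 'm, 'r) form) \<Rightarrow> ('a, 'm, 'r) form set" where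
  "algebraic_ideal \<rho> W n \<sigma> =
     {(\<lambda>p vs. \<Sum>k = 1..n. (\<alpha> k \<^bold>\<and> \<sigma> k) p vs) | \<alpha>. \<forall>k\<in>{1..n}. \<alpha> k \<in> forms \<rho> W}"

definition differential_ideal ::
  "(('a, 'm, 'r) form \<Rightarrow> ('a, 'm, 'r) form) \<Rightarrow> ('a, 'm, 'r) form set \<Rightarrow> bool" where
  "differential_ideal \<delta> I \<longleftrightarrow> (\<forall>\<omega>\<in>I. \<delta> \<omega> \<in> I)"


section \<open>Solutions of the system\<close>

definition X_field :: "(real^'m \<Rightarrow> real^'a \<Rightarrow> real^'m) \<Rightarrow> 'a \<Rightarrow> (real^'m \<Rightarrow> real) \<Rightarrow> real^'m \<Rightarrow> real" where
  "X_field \<rho> \<alpha> g x =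
     (\<Sum>i\<in>UNIV. anchor_coeff \<rho> i \<alpha> x * frechet_derivative g (at x) (axis i 1))"

(* Y_alpha(F), evaluated at y = ybar(x) *)
definition Y_field ::
  "(real^'m \<Rightarrow> real^'a \<Rightarrow> real^'m) \<Rightarrow> (real^'m \<Rightarrow> real^'r) \<Rightarrow> 'a
    \<Rightarrow> ((real^'m) \<times> (real^'r) \<Rightarrow> real) \<Rightarrow> real^'m \<Rightarrow> real" where
  "Y_field \<rho> ybar \<alpha> F x =
     (\<Sum>i\<in>UNIV. anchor_coeff \<rho> i \<alpha> x * partial_x i F (x, ybar x)) +
     (\<Sum>\<nu>\<in>UNIV. X_field \<rho> \<alpha> (\<lambda>x'. ybar x' $ \<nu>) x * partial_y \<nu> F (x, ybar x))"

definition is_solution ::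
  "(real^'m \<Rightarrow> real^'a \<Rightarrow> real^'m) \<Rightarrow> ((real^'m) \<times> (real^'r)) set \<Rightarrow> nat
    \<Rightarrow> (nat \<Rightarrow> 'a \<Rightarrow> (real^'m) \<times> (real^'r) \<Rightarrow> real) \<Rightarrow> (nat \<Rightarrow> 'r \<Rightarrow> (real^'m) \<times> (real^'r) \<Rightarrow> real)
    \<Rightarrow> (real^'m) set \<Rightarrow> (real^'m \<Rightarrow> real^'r) \<Rightarrow> bool" where
  "is_solution \<rho> W n \<theta> varpi V ybar \<longleftrightarrow>
     open V \<and> (\<forall>x\<in>V. (x, ybar x) \<in> W) \<and> (\<forall>x\<in>V. ybar differentiable (at x)) \<and>
     (\<forall>k\<in>{1..n}. \<forall>\<alpha>. \<forall>x\<in>V.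
        \<theta> k \<alpha> (x, ybar x) +
        (\<Sum>\<mu>\<in>UNIV. (\<Sum>i\<in>UNIV. anchor_coeff \<rho> i \<alpha> x *
             frechet_derivative (\<lambda>x'. ybar x' $ \<mu>) (at x) (axis i 1)) * varpi k \<mu> (x, ybar x)) = 0)"


section \<open>Existence of the exterior derivative\<close>

text \<open>
  \<^const>\<open>exterior_derivative\<close> only lists the determining properties of \<open>\<delta>\<close>.  The rest of this theory
  shows that they can be met on every Lie algebroid and every fibred chart.  In the local basis,
  \<open>\<delta>\<close> is built by Cartan's formula \<open>\<iota>\<^sub>c \<delta> = L\<^sub>c - \<delta> \<iota>\<^sub>c\<close>, recursively in the list of arguments, where
  \<open>c\<close> is a section with constant coefficients.
\<close>

lemma fd_eq: "(f has_derivative f') (at x) \<Longrightarrow> frechet_derivative f (at x) = f'"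
  by (rule frechet_derivative_at[symmetric])

lemma fd_cong:
  assumes "open S" "x \<in> S" "\<And>y. y \<in> S \<Longrightarrow> f y = g y"
  shows "frechet_derivative f (at x) = frechet_derivative g (at x)"
    and "f differentiable (at x) \<longleftrightarrow> g differentiable (at x)"
proof -
  have e: "(f has_derivative coeff_diff) (at x) \<longleftrightarrow> (g has_derivative coeff_diff) (at x)" for coeff_diff
    using assms has_derivative_transform_within_open[of f coeff_diff x UNIV S g]
      has_derivative_transform_within_open[of g coeff_diff x UNIV S f] by auto
  show "frechet_derivative f (at x) = frechet_derivative g (at x)"
    unfolding frechet_derivative_def e by simp
  show "f differentiable (at x) \<longleftrightarrow> g differentiable (at x)"
    unfolding differentiable_def e by simp
qed

lemma Ck_cong:
  assumes "open S"
  shows "(\<And>y. y \<in> S \<Longrightarrow> f y = g y) \<Longrightarrow> Ck_on k S f \<Longrightarrow> Ck_on k S g"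
proof (induction k arbitrary: f g)
  case 0 then show ?case by (simp cong: continuous_on_cong)
next
  case (Suc k)
  have d: "\<forall>x\<in>S. frechet_derivative f (at x) = frechet_derivative g (at x)"
    using fd_cong(1)[OF assms] Suc.prems(1) by blast
  have "Ck_on k S (\<lambda>x. frechet_derivative g (at x) v)" for v
    by (rule Suc.IH[of "\<lambda>x. frechet_derivative f (at x) v"]) (use d Suc.prems in auto)
  moreover have "\<forall>x\<in>S. g differentiable (at x)"
    using fd_cong(2)[OF assms, of _ f g] Suc.prems by simp
  ultimately show ?case by simp
qed

lemma Ck_Suc_D: "Ck_on (Suc k) S f \<Longrightarrow> Ck_on k S f"
proof (induction k arbitrary: f)
  case 0 then show ?case
    by (simp add: differentiable_imp_continuous_within continuous_at_imp_continuous_on)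
next
  case (Suc k) then show ?case by (metis Ck_on.simps(2))
qed

lemma Ck_const: "open S \<Longrightarrow> Ck_on k S (\<lambda>x. c)"
  by (induction k arbitrary: c) auto

lemma Ck_add: "open S \<Longrightarrow> Ck_on k S f \<Longrightarrow> Ck_on k S g \<Longrightarrow> Ck_on k S (\<lambda>x. f x + g x)"
proof (induction k arbitrary: f g)
  case 0 then show ?case by (simp add: continuous_on_add)
next
  case (Suc k)
  have "Ck_on k S (\<lambda>x. frechet_derivative (\<lambda>x. f x + g x) (at x) v)" for v
    apply (rule Ck_cong[OF \<open>open S\<close>, of "\<lambda>x. frechet_derivative f (at x) v + frechet_derivative g (at x) v"])
    using Suc by (auto simp: fd_eq[OF has_derivative_add[OF frechet_derivative_works[THEN iffD1] frechet_derivative_works[THEN iffD1]]])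
  then show ?case using Suc by auto
qed

lemma Ck_mult:
  fixes f g :: "_ \<Rightarrow> real"
  shows "open S \<Longrightarrow> Ck_on k S f \<Longrightarrow> Ck_on k S g \<Longrightarrow> Ck_on k S (\<lambda>x. f x * g x)"
proof (induction k arbitrary: f g)
  case 0 then show ?case by (simp add: continuous_on_mult)
next
  case (Suc k)
  have fd: "frechet_derivative (\<lambda>x. f x * g x) (at x) v
      = f x * frechet_derivative g (at x) v + frechet_derivative f (at x) v * g x" if "x \<in> S" for x v
  proof -
    have "(f has_derivative frechet_derivative f (at x)) (at x)"
      "(g has_derivative frechet_derivative g (at x)) (at x)"
      using Suc.prems that by (auto simp: frechet_derivative_works)
    from fd_eq[OF has_derivative_mult[OF this]] show ?thesis by simp
  qed
  have "Ck_on k S (\<lambda>x. frechet_derivative (\<lambda>x. f x * g x) (at x) v)" for v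
    apply (rule Ck_cong[OF \<open>open S\<close>, of "\<lambda>x. f x * frechet_derivative g (at x) v + frechet_derivative f (at x) v * g x"])
    apply (simp add: fd)
    apply (intro Ck_add Suc.IH Suc.prems(1) Ck_Suc_D[OF Suc.prems(2)] Ck_Suc_D[OF Suc.prems(3)])
    using Suc.prems by simp_all
  then show ?case using Suc by auto
qed

lemma Ck_bl:
  assumes "bounded_linear L"
  shows "open S \<Longrightarrow> Ck_on k S f \<Longrightarrow> Ck_on k S (\<lambda>x. L (f x))"
proof (induction k arbitrary: f)
  case 0 then show ?case using bounded_linear.continuous_on[OF assms] by auto
next
  case (Suc k)
  have fd: "((\<lambda>x. L (f x)) has_derivative (\<lambda>v. L (frechet_derivative f (at x) v))) (at x)" if "x \<in> S" for x
    using bounded_linear.has_derivative[OF assms] Suc.prems that by (auto simp: frechet_derivative_works)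
  have "Ck_on k S (\<lambda>x. frechet_derivative (\<lambda>x. L (f x)) (at x) v)" for v
    apply (rule Ck_cong[OF \<open>open S\<close>, of "\<lambda>x. L (frechet_derivative f (at x) v)"])
    using Suc by (auto simp: fd_eq[OF fd])
  then show ?case using fd unfolding Ck_on.simps differentiable_def by blast
qed

lemma Ck_fst:
  assumes "open W" "open U" "fst ` W \<subseteq> U"
  shows "Ck_on k U f \<Longrightarrow> Ck_on k W (\<lambda>p. f (fst p))"
proof (induction k arbitrary: f)
  case 0 then show ?case using assms
    by (auto intro!: continuous_on_compose2[of U f W fst] continuous_intros)
next
  case (Suc k)
  have fd: "((\<lambda>p. f (fst p)) has_derivative (\<lambda>v. frechet_derivative f (at (fst p)) (fst v))) (at p)" if "p \<in> W" for p
  proof -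
    have "(f has_derivative frechet_derivative f (at (fst p))) (at (fst p))"
      using Suc.prems that assms by (auto simp: frechet_derivative_works)
    from has_derivative_compose[OF has_derivative_fst[OF has_derivative_ident] this]
    show ?thesis by simp
  qed
  have "Ck_on k W (\<lambda>p. frechet_derivative (\<lambda>p. f (fst p)) (at p) v)" for v
    apply (rule Ck_cong[OF \<open>open W\<close>, of "\<lambda>p. frechet_derivative f (at (fst p)) (fst v)"])
    using Suc by (auto simp: fd_eq[OF fd])
  then show ?case using fd unfolding Ck_on.simps differentiable_def by blast
qed

lemma smooth_const: "open S \<Longrightarrow> smooth_on S (\<lambda>x. c)" by (simp add: smooth_on_def Ck_const)
lemma smooth_add: "open S \<Longrightarrow> smooth_on S f \<Longrightarrow> smooth_on S g \<Longrightarrow> smooth_on S (\<lambda>x. f x + g x)"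
  by (simp add: smooth_on_def Ck_add)
lemma smooth_mult: "open S \<Longrightarrow> smooth_on S f \<Longrightarrow> smooth_on S g \<Longrightarrow> smooth_on S (\<lambda>x. f x * g x :: real)"
  by (simp add: smooth_on_def Ck_mult)
lemma smooth_diff: "open S \<Longrightarrow> smooth_on S f \<Longrightarrow> smooth_on S g \<Longrightarrow> smooth_on S (\<lambda>x. f x - g x :: real)"
  using smooth_add[of S f "\<lambda>x. (-1) * g x"] smooth_mult[of S "\<lambda>x. -1" g] smooth_const[of S "-1::real"] by simp
lemma smooth_sum: "open S \<Longrightarrow> (\<And>i. i \<in> I \<Longrightarrow> smooth_on S (f i)) \<Longrightarrow> smooth_on S (\<lambda>x. \<Sum>i\<in>I. f i x)"
proof (induction I rule: infinite_finite_induct)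
  case (insert i I) then show ?case by (simp add: smooth_add)
qed (auto intro: smooth_const)
lemma smooth_cong: "open S \<Longrightarrow> smooth_on S f \<Longrightarrow> (\<And>y. y \<in> S \<Longrightarrow> f y = g y) \<Longrightarrow> smooth_on S g"
  unfolding smooth_on_def using Ck_cong[of S f g] by blast
lemma smooth_nth: "open S \<Longrightarrow> smooth_on S f \<Longrightarrow> smooth_on S (\<lambda>x. f x $ i)"
  unfolding smooth_on_def using Ck_bl[OF bounded_linear_vec_nth, of S] by blast
lemma smooth_fst: "open W \<Longrightarrow> open U \<Longrightarrow> fst ` W \<subseteq> U \<Longrightarrow> smooth_on U f \<Longrightarrow> smooth_on W (\<lambda>p. f (fst p))"
  unfolding smooth_on_def using Ck_fst by blast
lemma smooth_fd: "smooth_on S f \<Longrightarrow> smooth_on S (\<lambda>x. frechet_derivative f (at x) v)"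
  unfolding smooth_on_def by (metis Ck_on.simps(2))
lemma smooth_differentiable: "smooth_on S f \<Longrightarrow> x \<in> S \<Longrightarrow> f differentiable (at x)"
  unfolding smooth_on_def by (metis Ck_on.simps(2))


definition list_wedge :: "('v list \<Rightarrow> real) \<Rightarrow> ('v list \<Rightarrow> real) \<Rightarrow> 'v list \<Rightarrow> real" where
  "list_wedge \<phi> \<psi> vs = (\<Sum>S\<in>Pow {..<length vs}. shuffle_sign (length vs) S * \<phi> (nths vs S) * \<psi> (nths vs (- S)))"

definition grade_inv :: "('v list \<Rightarrow> real) \<Rightarrow> 'v list \<Rightarrow> real" where
  "grade_inv \<phi> us = (-1) ^ length us * \<phi> us"

lemma finite_inv: "finite {(i, j). i < j \<and> j < (n::nat) \<and> i \<notin> S \<and> j \<in> S}"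
  by (rule finite_subset[of _ "{..<n} \<times> {..<n}"]) auto

lemma Suc_image_iff: "Suc i \<in> Suc ` T \<longleftrightarrow> i \<in> T" by auto

lemma shuffle_sign_1: "shuffle_sign (Suc n) (insert 0 (Suc ` T)) = shuffle_sign n T"
proof -
  have "{(i, j). i < j \<and> j < Suc n \<and> i \<notin> insert 0 (Suc ` T) \<and> j \<in> insert 0 (Suc ` T)}
     = (\<lambda>(i,j). (Suc i, Suc j)) ` {(i, j). i < j \<and> j < n \<and> i \<notin> T \<and> j \<in> T}" (is "?L = ?f ` ?R")
  proof (intro set_eqI iffI)
    fix z assume "z \<in> ?L"
    then obtain i j where z: "z = (i, j)" "i < j" "j < Suc n" "i \<noteq> 0" "i \<notin> Suc ` T" "j \<in> Suc ` T" by auto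
    obtain i' where i: "i = Suc i'" using z by (cases i) auto
    obtain j' where j: "j = Suc j'" "j' \<in> T" using z by auto
    have "(i', j') \<in> ?R" using z i j by auto
    then show "z \<in> ?f ` ?R" using z i j by (intro image_eqI[of _ _ "(i', j')"]) auto
  qed auto
  moreover have "card (?f ` ?R) = card ?R" by (rule card_image) (auto simp: inj_on_def)
  ultimately show ?thesis unfolding shuffle_sign_def by (simp only:)
qed

lemma shuffle_sign_2:
  assumes "T \<subseteq> {..<n}"
  shows "shuffle_sign (Suc n) (Suc ` T) = (-1) ^ card T * shuffle_sign n T"
proof -
  let ?f = "\<lambda>(i::nat,j::nat). (Suc i, Suc j)"
  let ?R = "{(i, j). i < j \<and> j < n \<and> i \<notin> T \<and> j \<in> T}"
  have "{(i, j). i < j \<and> j < Suc n \<and> i \<notin> Suc ` T \<and> j \<in> Suc ` T}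
     = (\<lambda>j. (0, Suc j)) ` T \<union> ?f ` ?R" (is "?L = _")
  proof (intro set_eqI iffI)
    fix z assume "z \<in> ?L"
    then obtain i j where z: "z = (i, j)" "i < j" "j < Suc n" "i \<notin> Suc ` T" "j \<in> Suc ` T" by auto
    then obtain j' where j: "j = Suc j'" "j' \<in> T" by auto
    show "z \<in> (\<lambda>j. (0, Suc j)) ` T \<union> ?f ` ?R"
    proof (cases i)
      case 0 then show ?thesis using z j by auto
    next
      case (Suc i') then show ?thesis using z j by (auto simp: image_iff)
    qed
  qed (use assms in auto)
  moreover have "card ((\<lambda>j. (0::nat, Suc j)) ` T \<union> ?f ` ?R) = card T + card ?R"
  proof -
    have "finite T" using assms finite_subset by auto
    then have "card ((\<lambda>j. (0::nat, Suc j)) ` T \<union> ?f ` ?R) = card ((\<lambda>j. (0::nat, Suc j)) ` T) + card (?f ` ?R)"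
      by (intro card_Un_disjoint finite_imageI finite_inv) auto
    moreover have "card (?f ` ?R) = card ?R" by (rule card_image) (auto simp: inj_on_def)
    moreover have "card ((\<lambda>j. (0::nat, Suc j)) ` T) = card T" by (rule card_image) (auto simp: inj_on_def)
    ultimately show ?thesis by simp
  qed
  ultimately show ?thesis unfolding shuffle_sign_def by (simp add: power_add)
qed

lemma Pow_lessThan_Suc_shift:
  "Pow {..<Suc n} = (\<lambda>T. insert 0 (Suc ` T)) ` Pow {..<n} \<union> (`) Suc ` Pow {..<n}" (is "_ = ?R")
proof (intro set_eqI iffI)
  fix S assume S: "S \<in> Pow {..<Suc n}"
  let ?T = "{j. Suc j \<in> S}"
  have "?T \<in> Pow {..<n}" using S by auto
  moreover have "S = (if 0 \<in> S then insert 0 (Suc ` ?T) else Suc ` ?T)"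
  proof (rule set_eqI)
    fix i show "i \<in> S \<longleftrightarrow> i \<in> (if 0 \<in> S then insert 0 (Suc ` ?T) else Suc ` ?T)"
      by (cases i) auto
  qed
  ultimately show "S \<in> ?R" by (metis (no_types, lifting) UnCI image_eqI)
qed auto

lemma wl_Nil [simp]: "list_wedge \<phi> \<psi> [] = \<phi> [] * \<psi> []"
  by (simp add: list_wedge_def shuffle_sign_def)

lemma wl_Cons [simp]:
  "list_wedge \<phi> \<psi> (v # vs) = list_wedge (\<lambda>us. \<phi> (v # us)) \<psi> vs + list_wedge (grade_inv \<phi>) (\<lambda>us. \<psi> (v # us)) vs"
proof -
  let ?n = "length vs"
  let ?t = "\<lambda>S. shuffle_sign (Suc ?n) S * \<phi> (nths (v#vs) S) * \<psi> (nths (v#vs) (- S))"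
  have "list_wedge \<phi> \<psi> (v # vs) = sum ?t ((\<lambda>T. insert 0 (Suc ` T)) ` Pow {..<?n} \<union> (`) Suc ` Pow {..<?n})"
    unfolding list_wedge_def Pow_lessThan_Suc_shift[symmetric] by simp
  also have "\<dots> = sum ?t ((\<lambda>T. insert 0 (Suc ` T)) ` Pow {..<?n}) + sum ?t ((`) Suc ` Pow {..<?n})"
    by (rule sum.union_disjoint) auto
  also have "sum ?t ((\<lambda>T. insert 0 (Suc ` T)) ` Pow {..<?n}) = list_wedge (\<lambda>us. \<phi> (v # us)) \<psi> vs"
  proof -
    have "inj (\<lambda>T. insert 0 (Suc ` T))"
      by (rule inj_on_inverseI[where g="\<lambda>S. {j. Suc j \<in> S}"]) auto
    then have "sum ?t ((\<lambda>T. insert 0 (Suc ` T)) ` Pow {..<?n}) = (\<Sum>T\<in>Pow {..<?n}. ?t (insert 0 (Suc ` T)))"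
      by (subst sum.reindex) (auto intro: inj_on_subset)
    also have "\<dots> = list_wedge (\<lambda>us. \<phi> (v # us)) \<psi> vs"
      unfolding list_wedge_def
    proof (intro sum.cong refl)
      fix T :: "nat set"
      have "{j. Suc j \<in> - insert 0 (Suc ` T)} = - T" "{j. Suc j \<in> insert 0 (Suc ` T)} = T" by auto
      then have "nths (v # vs) (insert 0 (Suc ` T)) = v # nths vs T"
        "nths (v # vs) (- insert 0 (Suc ` T)) = nths vs (- T)"
        by (simp_all add: nths_Cons del: Compl_insert)
      then show "?t (insert 0 (Suc ` T)) = shuffle_sign ?n T * \<phi> (v # nths vs T) * \<psi> (nths vs (- T))"
        by (simp only: shuffle_sign_1)
    qed
    finally show ?thesis .
  qed
  also have "sum ?t ((`) Suc ` Pow {..<?n}) = list_wedge (grade_inv \<phi>) (\<lambda>us. \<psi> (v # us)) vs"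
  proof -
    have "inj ((`) Suc)"
      by (rule inj_on_inverseI[where g="\<lambda>S. {j. Suc j \<in> S}"]) auto
    then have "sum ?t ((`) Suc ` Pow {..<?n}) = (\<Sum>T\<in>Pow {..<?n}. ?t (Suc ` T))"
      by (subst sum.reindex) (auto intro: inj_on_subset)
    also have "\<dots> = list_wedge (grade_inv \<phi>) (\<lambda>us. \<psi> (v # us)) vs"
      unfolding list_wedge_def
    proof (intro sum.cong refl)
      fix T assume T: "T \<in> Pow {..<?n}"
      have "{i. i < ?n \<and> i \<in> T} = T" using T by auto
      then have "length (nths vs T) = card T" by (simp add: length_nths)
      moreover have "{j. Suc j \<in> - Suc ` T} = - T" "{j. Suc j \<in> Suc ` T} = T" by auto
      ultimately show "?t (Suc ` T) = shuffle_sign ?n T * grade_inv \<phi> (nths vs T) * \<psi> (v # nths vs (- T))"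
        using shuffle_sign_2[of T ?n] T by (simp add: nths_Cons grade_inv_def)
    qed
    finally show ?thesis .
  qed
  finally show ?thesis .
qed

lemma wl_linear_left: "list_wedge (\<lambda>us. c * \<phi> us + \<phi>' us) \<psi> vs = c * list_wedge \<phi> \<psi> vs + list_wedge \<phi>' \<psi> vs"
  unfolding list_wedge_def sum_distrib_left sum.distrib[symmetric] by (intro sum.cong refl) (simp add: algebra_simps)
lemma wl_linear_right: "list_wedge \<phi> (\<lambda>us. c * \<psi> us + \<psi>' us) vs = c * list_wedge \<phi> \<psi> vs + list_wedge \<phi> \<psi>' vs"
  unfolding list_wedge_def sum_distrib_left sum.distrib[symmetric] by (intro sum.cong refl) (simp add: algebra_simps)
lemma wl_sum_left: "list_wedge (\<lambda>us. \<Sum>i\<in>I. c i * \<phi> i us) \<psi> vs = (\<Sum>i\<in>I. c i * list_wedge (\<phi> i) \<psi> vs)"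
  unfolding list_wedge_def sum_distrib_left sum_distrib_right
  by (rule trans[OF sum.swap]) (simp add: mult_ac)
lemma wl_sum_right: "list_wedge \<phi> (\<lambda>us. \<Sum>i\<in>I. c i * \<psi> i us) vs = (\<Sum>i\<in>I. c i * list_wedge \<phi> (\<psi> i) vs)"
  unfolding list_wedge_def sum_distrib_left sum_distrib_right
  by (rule trans[OF sum.swap]) (simp add: mult_ac)
lemma wl_map: "list_wedge \<phi> \<psi> (map f vs) = list_wedge (\<lambda>us. \<phi> (map f us)) (\<lambda>us. \<psi> (map f us)) vs"
  by (simp add: list_wedge_def nths_map)

lemma wedge_wl: "(\<omega> \<^bold>\<and> \<eta>) p = list_wedge (\<omega> p) (\<eta> p)"
  by (rule ext) (simp add: wedge_def list_wedge_def)


locale prolongation_chart = lie_algebroid U \<rho> br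
  for U :: "(real^'m) set" and \<rho> :: "real^'m \<Rightarrow> real^'a \<Rightarrow> real^'m" and br +
  fixes W :: "((real^'m) \<times> (real^'r)) set"
  assumes W_open: "open W" and W_base: "fst ` W = U"
begin

definition structure_at :: "(real^'m) \<times> (real^'r) \<Rightarrow> 'a \<Rightarrow> (real^'a) \<times> (real^'r) \<Rightarrow> (real^'a) \<times> (real^'r) \<Rightarrow> real" where
  "structure_at p \<gamma> c c' = (\<Sum>\<alpha>\<in>UNIV. \<Sum>\<beta>\<in>UNIV. bracket_coeff U br \<gamma> \<alpha> \<beta> (fst p) * (fst c $ \<alpha> * fst c' $ \<beta>))"

definition anchor_at :: "(real^'m) \<times> (real^'r) \<Rightarrow> (real^'a) \<times> (real^'r) \<Rightarrow> (real^'m) \<times> (real^'r)" where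
  "anchor_at p c = (\<rho> (fst p) (fst c), snd c)"

primrec slot_bracket :: "(real^'m) \<times> (real^'r) \<Rightarrow> (real^'a) \<times> (real^'r) \<Rightarrow> ((real^'a) \<times> (real^'r)) list
    \<Rightarrow> (((real^'a) \<times> (real^'r)) list \<Rightarrow> real) \<Rightarrow> real" where
  "slot_bracket p c [] \<phi> = 0"
| "slot_bracket p c (v # vs) \<phi> = (\<Sum>\<gamma>\<in>UNIV. structure_at p \<gamma> c v * \<phi> ((axis \<gamma> 1, 0) # vs)) + slot_bracket p c vs (\<lambda>us. \<phi> (v # us))"

definition triv_lie where
  "triv_lie c \<omega> p cs = frechet_derivative (\<lambda>q. \<omega> q cs) (at p) (anchor_at p c) - slot_bracket p c cs (\<omega> p)"

primrec triv_d where
  "triv_d [] \<omega> p = 0"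
| "triv_d (c # cs) \<omega> p = triv_lie c \<omega> p cs - triv_d cs (\<lambda>q us. \<omega> q (c # us)) p"

definition coeff_diff where "coeff_diff \<omega> \<longleftrightarrow> (\<forall>us. \<forall>p\<in>W. (\<lambda>q. \<omega> q us) differentiable (at p))"

lemma D_Cons: "coeff_diff \<omega> \<Longrightarrow> coeff_diff (\<lambda>q us. \<omega> q (c # us))" by (simp add: coeff_diff_def)
lemma D_gr: "coeff_diff \<omega> \<Longrightarrow> coeff_diff (\<lambda>q. grade_inv (\<omega> q))" by (simp add: coeff_diff_def grade_inv_def)

lemma fd_lin:
  fixes f g :: "_ \<Rightarrow> real"
  assumes "f differentiable (at p)" "g differentiable (at p)"
  shows "frechet_derivative (\<lambda>q. k * f q + g q) (at p) v
    = k * frechet_derivative f (at p) v + frechet_derivative g (at p) v"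
proof -
  have "(f has_derivative frechet_derivative f (at p)) (at p)" "(g has_derivative frechet_derivative g (at p)) (at p)"
    using assms by (auto simp: frechet_derivative_works)
  from fd_eq[OF has_derivative_add[OF has_derivative_mult_right[OF this(1), of k] this(2)]] show ?thesis by simp
qed

lemma brk_lin: "slot_bracket p c cs (\<lambda>us. k * \<phi> us + \<psi> us) = k * slot_bracket p c cs \<phi> + slot_bracket p c cs \<psi>"
  by (induction cs arbitrary: \<phi> \<psi>) (simp_all add: algebra_simps sum.distrib sum_distrib_left)

lemma lie_lin:
  assumes "coeff_diff \<omega>" "coeff_diff \<eta>" "p \<in> W"
  shows "triv_lie c (\<lambda>q us. k * \<omega> q us + \<eta> q us) p cs = k * triv_lie c \<omega> p cs + triv_lie c \<eta> p cs"
  using assms by (simp add: triv_lie_def fd_lin coeff_diff_def brk_lin right_diff_distrib)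

lemma dt_lin:
  assumes "p \<in> W"
  shows "coeff_diff \<omega> \<Longrightarrow> coeff_diff \<eta> \<Longrightarrow> triv_d cs (\<lambda>q us. k * \<omega> q us + \<eta> q us) p = k * triv_d cs \<omega> p + triv_d cs \<eta> p"
  by (induction cs arbitrary: \<omega> \<eta>) (simp_all add: lie_lin assms D_Cons right_diff_distrib)

lemma fd_W_cong: "p \<in> W \<Longrightarrow> (\<And>q. q \<in> W \<Longrightarrow> f q = g q) \<Longrightarrow>
    frechet_derivative f (at p) = frechet_derivative g (at p)"
  using fd_cong(1)[OF W_open] by blast

lemma brk_cong: "(\<And>us. length us = length cs \<Longrightarrow> \<phi> us = \<psi> us) \<Longrightarrow> slot_bracket p c cs \<phi> = slot_bracket p c cs \<psi>"
proof (induction cs arbitrary: \<phi> \<psi>)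
  case (Cons v vs)
  have "slot_bracket p c vs (\<lambda>us. \<phi> (v # us)) = slot_bracket p c vs (\<lambda>us. \<psi> (v # us))" by (rule Cons.IH) (simp add: Cons.prems)
  then show ?case by (simp add: Cons.prems)
qed simp

lemma lie_cong:
  assumes "p \<in> W" "\<And>q us. q \<in> W \<Longrightarrow> length us = length cs \<Longrightarrow> \<omega> q us = \<eta> q us"
  shows "triv_lie c \<omega> p cs = triv_lie c \<eta> p cs"
  unfolding triv_lie_def using fd_W_cong[of p "\<lambda>q. \<omega> q cs" "\<lambda>q. \<eta> q cs"] brk_cong[of cs "\<omega> p" "\<eta> p"] assms by simp

lemma dt_cong:
  assumes "p \<in> W"
  shows "(\<And>q us. q \<in> W \<Longrightarrow> Suc (length us) = length cs \<Longrightarrow> \<omega> q us = \<eta> q us) \<Longrightarrow> triv_d cs \<omega> p = triv_d cs \<eta> p"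
proof (induction cs arbitrary: \<omega> \<eta>)
  case (Cons c cs)
  have "triv_d cs (\<lambda>q us. \<omega> q (c # us)) p = triv_d cs (\<lambda>q us. \<eta> q (c # us)) p" by (rule Cons.IH) (simp add: Cons.prems)
  moreover have "triv_lie c \<omega> p cs = triv_lie c \<eta> p cs" by (rule lie_cong) (auto simp: assms Cons.prems)
  ultimately show ?case by simp
qed simp

lemma D_zero: "coeff_diff (\<lambda>q us. 0)" by (simp add: coeff_diff_def)

lemma dt_zero: "p \<in> W \<Longrightarrow> triv_d cs (\<lambda>q us. 0) p = 0"
  using dt_lin[of p "\<lambda>q us. 0" "\<lambda>q us. 0" cs 1] D_zero by simp

lemma dt_eq_zero:
  assumes "p \<in> W" "\<And>q us. q \<in> W \<Longrightarrow> Suc (length us) = length cs \<Longrightarrow> \<omega> q us = 0"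
  shows "triv_d cs \<omega> p = 0"
  using dt_cong[OF assms(1), of cs \<omega> "\<lambda>q us. 0"] dt_zero assms by simp

lemma gr_Cons: "grade_inv \<phi> (v # us) = - grade_inv (\<lambda>us. \<phi> (v # us)) us" by (simp add: grade_inv_def)

lemma brk_gr: "slot_bracket p c cs (grade_inv \<phi>) = (-1) ^ length cs * slot_bracket p c cs \<phi>"
proof -
  have "slot_bracket p c cs (grade_inv \<phi>) = slot_bracket p c cs (\<lambda>us. (-1) ^ length cs * \<phi> us + 0)"
    by (rule brk_cong) (simp add: grade_inv_def)
  also have "\<dots> = (-1) ^ length cs * slot_bracket p c cs \<phi>"
    by (subst brk_lin) (induction cs, auto)
  finally show ?thesis .
qed

lemma gr_brk: "grade_inv (\<lambda>cs. slot_bracket p c cs \<phi>) cs = slot_bracket p c cs (grade_inv \<phi>)"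
  by (simp add: brk_gr) (simp add: grade_inv_def)

lemma wl_neg_left: "list_wedge (\<lambda>us. - \<phi> us) \<psi> vs = - list_wedge \<phi> \<psi> vs"
  using wl_linear_left[of "-1" \<phi> "\<lambda>us. 0" \<psi> vs] by (simp add: list_wedge_def)

lemma wl_add_left: "list_wedge (\<lambda>us. \<phi> us + \<phi>' us) \<psi> vs = list_wedge \<phi> \<psi> vs + list_wedge \<phi>' \<psi> vs"
  using wl_linear_left[of 1 \<phi> \<phi>' \<psi> vs] by simp
lemma wl_diff_left: "list_wedge (\<lambda>us. \<phi> us - \<phi>' us) \<psi> vs = list_wedge \<phi> \<psi> vs - list_wedge \<phi>' \<psi> vs"
  using wl_linear_left[of "-1" \<phi>' \<phi> \<psi> vs] by simp
lemma wl_add_right: "list_wedge \<psi> (\<lambda>us. \<phi> us + \<phi>' us) vs = list_wedge \<psi> \<phi> vs + list_wedge \<psi> \<phi>' vs"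
  using wl_linear_right[of \<psi> 1 \<phi> \<phi>' vs] by simp
lemma wl_diff_right: "list_wedge \<psi> (\<lambda>us. \<phi> us - \<phi>' us) vs = list_wedge \<psi> \<phi> vs - list_wedge \<psi> \<phi>' vs"
  using wl_linear_right[of \<psi> "-1" \<phi>' \<phi> vs] by simp

lemma brk_wl: "slot_bracket p c cs (list_wedge \<phi> \<psi>) = list_wedge (\<lambda>us. slot_bracket p c us \<phi>) \<psi> cs + list_wedge \<phi> (\<lambda>us. slot_bracket p c us \<psi>) cs"
proof (induction cs arbitrary: \<phi> \<psi>)
  case (Cons v vs)
  have s: "slot_bracket p c vs (\<lambda>us. list_wedge (\<lambda>us. \<phi> (v # us)) \<psi> us + list_wedge (grade_inv \<phi>) (\<lambda>us. \<psi> (v # us)) us)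
     = slot_bracket p c vs (list_wedge (\<lambda>us. \<phi> (v # us)) \<psi>) + slot_bracket p c vs (list_wedge (grade_inv \<phi>) (\<lambda>us. \<psi> (v # us)))"
    using brk_lin[of p c vs 1] by simp
  have g: "(\<lambda>cs. slot_bracket p c cs (grade_inv \<phi>)) = grade_inv (\<lambda>cs. slot_bracket p c cs \<phi>)" by (rule ext) (simp add: gr_brk)
  show ?case
    by (simp add: s Cons.IH wl_add_left wl_add_right wl_sum_left wl_sum_right g algebra_simps sum.distrib)
qed simp

lemma D_wl: "coeff_diff \<omega> \<Longrightarrow> coeff_diff \<eta> \<Longrightarrow> coeff_diff (\<lambda>q. list_wedge (\<omega> q) (\<eta> q))"
  unfolding coeff_diff_def list_wedge_def by (auto intro!: differentiable_sum differentiable_mult)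

lemma fd_mult:
  fixes f g :: "_ \<Rightarrow> real"
  assumes "f differentiable (at p)" "g differentiable (at p)"
  shows "frechet_derivative (\<lambda>q. f q * g q) (at p) v
    = frechet_derivative f (at p) v * g p + f p * frechet_derivative g (at p) v"
proof -
  have "(f has_derivative frechet_derivative f (at p)) (at p)" "(g has_derivative frechet_derivative g (at p)) (at p)"
    using assms by (auto simp: frechet_derivative_works)
  from fd_eq[OF has_derivative_mult[OF this]] show ?thesis by simp
qed

lemma fd_sum:
  fixes f :: "_ \<Rightarrow> _ \<Rightarrow> real"
  assumes "\<And>i. i \<in> I \<Longrightarrow> f i differentiable (at p)"
  shows "frechet_derivative (\<lambda>q. \<Sum>i\<in>I. k i * f i q) (at p) v = (\<Sum>i\<in>I. k i * frechet_derivative (f i) (at p) v)"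
proof -
  have "(f i has_derivative frechet_derivative (f i) (at p)) (at p)" if "i \<in> I" for i
    using assms that by (auto simp: frechet_derivative_works)
  then have "((\<lambda>q. \<Sum>i\<in>I. k i * f i q) has_derivative (\<lambda>v. \<Sum>i\<in>I. k i * frechet_derivative (f i) (at p) v)) (at p)"
    by (intro has_derivative_sum has_derivative_mult_right)
  from fd_eq[OF this] show ?thesis by simp
qed

lemma fd_wl:
  assumes "coeff_diff \<omega>" "coeff_diff \<eta>" "p \<in> W"
  shows "frechet_derivative (\<lambda>q. list_wedge (\<omega> q) (\<eta> q) cs) (at p) v
    = list_wedge (\<lambda>us. frechet_derivative (\<lambda>q. \<omega> q us) (at p) v) (\<eta> p) cs
    + list_wedge (\<omega> p) (\<lambda>us. frechet_derivative (\<lambda>q. \<eta> q us) (at p) v) cs"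
proof -
  have d: "(\<lambda>q. \<omega> q us) differentiable (at p)" "(\<lambda>q. \<eta> q us) differentiable (at p)" for us
    using assms by (auto simp: coeff_diff_def)
  show ?thesis unfolding list_wedge_def sum.distrib[symmetric] mult.assoc
    by (subst fd_sum) (auto intro!: differentiable_mult sum.cong d simp: fd_mult d algebra_simps)
qed

lemma lie_wl:
  assumes "coeff_diff \<omega>" "coeff_diff \<eta>" "p \<in> W"
  shows "triv_lie c (\<lambda>q. list_wedge (\<omega> q) (\<eta> q)) p cs = list_wedge (\<lambda>us. triv_lie c \<omega> p us) (\<eta> p) cs + list_wedge (\<omega> p) (\<lambda>us. triv_lie c \<eta> p us) cs"
  using assms by (simp add: triv_lie_def fd_wl brk_wl wl_diff_left wl_diff_right)

lemma dt_gr: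
  assumes "p \<in> W" "coeff_diff \<omega>"
  shows "triv_d cs (\<lambda>q. grade_inv (\<omega> q)) p = - grade_inv (\<lambda>cs. triv_d cs \<omega> p) cs"
proof (cases cs)
  case (Cons c cs')
  have "triv_d cs (\<lambda>q. grade_inv (\<omega> q)) p = triv_d cs (\<lambda>q us. (-1) ^ length cs' * \<omega> q us + 0) p"
    by (rule dt_cong) (auto simp: Cons assms grade_inv_def)
  also have "\<dots> = (-1) ^ length cs' * triv_d cs \<omega> p"
    using assms by (subst dt_lin) (auto simp: D_zero dt_zero)
  finally show ?thesis by (simp add: grade_inv_def Cons)
qed (simp add: grade_inv_def)

lemma dt_wl:
  assumes p: "p \<in> W"
  shows "coeff_diff \<omega> \<Longrightarrow> coeff_diff \<eta> \<Longrightarrow> triv_d cs (\<lambda>q. list_wedge (\<omega> q) (\<eta> q)) p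
    = list_wedge (\<lambda>us. triv_d us \<omega> p) (\<eta> p) cs + list_wedge (grade_inv (\<omega> p)) (\<lambda>us. triv_d us \<eta> p) cs"
proof (induction cs arbitrary: \<omega> \<eta>)
  case (Cons c cs)
  let ?\<omega>' = "\<lambda>q us. \<omega> q (c # us)" and ?\<eta>' = "\<lambda>q us. \<eta> q (c # us)"
  note d = Cons.prems D_Cons[OF Cons.prems(1), of c] D_Cons[OF Cons.prems(2), of c] D_gr[OF Cons.prems(1)]
  have "triv_d (c # cs) (\<lambda>q. list_wedge (\<omega> q) (\<eta> q)) p = triv_lie c (\<lambda>q. list_wedge (\<omega> q) (\<eta> q)) p cs
      - triv_d cs (\<lambda>q us. 1 * list_wedge (?\<omega>' q) (\<eta> q) us + list_wedge (grade_inv (\<omega> q)) (?\<eta>' q) us) p"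
    by simp
  also have "\<dots> = triv_lie c (\<lambda>q. list_wedge (\<omega> q) (\<eta> q)) p cs
      - (triv_d cs (\<lambda>q. list_wedge (?\<omega>' q) (\<eta> q)) p + triv_d cs (\<lambda>q. list_wedge (grade_inv (\<omega> q)) (?\<eta>' q)) p)"
    by (subst dt_lin) (auto intro!: D_wl d p)
  also have "\<dots> = list_wedge (\<lambda>us. triv_lie c \<omega> p us) (\<eta> p) cs + list_wedge (\<omega> p) (\<lambda>us. triv_lie c \<eta> p us) cs
     - (list_wedge (\<lambda>us. triv_d us ?\<omega>' p) (\<eta> p) cs + list_wedge (grade_inv (?\<omega>' p)) (\<lambda>us. triv_d us \<eta> p) cs
      + (list_wedge (\<lambda>us. triv_d us (\<lambda>q. grade_inv (\<omega> q)) p) (?\<eta>' p) cs + list_wedge (grade_inv (grade_inv (\<omega> p))) (\<lambda>us. triv_d us ?\<eta>' p) cs))"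
    by (simp only: lie_wl Cons.IH d p)
  finally have e: "triv_d (c # cs) (\<lambda>q. list_wedge (\<omega> q) (\<eta> q)) p = list_wedge (\<lambda>us. triv_lie c \<omega> p us) (\<eta> p) cs + list_wedge (\<omega> p) (\<lambda>us. triv_lie c \<eta> p us) cs
     - (list_wedge (\<lambda>us. triv_d us ?\<omega>' p) (\<eta> p) cs + list_wedge (grade_inv (?\<omega>' p)) (\<lambda>us. triv_d us \<eta> p) cs
      + (list_wedge (\<lambda>us. triv_d us (\<lambda>q. grade_inv (\<omega> q)) p) (?\<eta>' p) cs + list_wedge (grade_inv (grade_inv (\<omega> p))) (\<lambda>us. triv_d us ?\<eta>' p) cs))" .
  have g: "(\<lambda>us. triv_d us (\<lambda>q. grade_inv (\<omega> q)) p) = (\<lambda>us. - grade_inv (\<lambda>cs. triv_d cs \<omega> p) us)"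
    by (rule ext) (rule dt_gr[OF p Cons.prems(1)])
  moreover have "(\<lambda>us. grade_inv (\<omega> p) (c # us)) = (\<lambda>us. - grade_inv (?\<omega>' p) us)" by (rule ext) (rule gr_Cons)
  moreover have "grade_inv (grade_inv (\<omega> p)) = \<omega> p" by (rule ext) (simp add: grade_inv_def power_mult_distrib[symmetric] flip: mult.assoc)
  ultimately show ?case
    by (simp add: e g wl_neg_left wl_diff_left wl_diff_right del: triv_d.simps(2)) (simp add: wl_neg_left wl_diff_left wl_diff_right)
qed (simp add: grade_inv_def)

end


definition multilin :: "('v::real_vector list \<Rightarrow> real) \<Rightarrow> bool" where
  "multilin \<phi> \<longleftrightarrow> (\<forall>us v w vs c. \<phi> (us @ (c *\<^sub>R v + w) # vs) = c * \<phi> (us @ v # vs) + \<phi> (us @ w # vs))"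
definition altern :: "('v::real_vector list \<Rightarrow> real) \<Rightarrow> bool" where
  "altern \<phi> \<longleftrightarrow> (\<forall>us v vs. \<phi> (us @ v # v # vs) = 0)"

lemma multilin_Cons: "multilin \<phi> \<Longrightarrow> multilin (\<lambda>us. \<phi> (u # us))" unfolding multilin_def by (metis append_Cons)
lemma altern_Cons: "altern \<phi> \<Longrightarrow> altern (\<lambda>us. \<phi> (u # us))" unfolding altern_def by (metis append_Cons)
lemma multilinD: "multilin \<phi> \<Longrightarrow> \<phi> (us @ (c *\<^sub>R v + w) # vs) = c * \<phi> (us @ v # vs) + \<phi> (us @ w # vs)"
  by (simp add: multilin_def)
lemma multilinD0: "multilin \<phi> \<Longrightarrow> \<phi> ((c *\<^sub>R v + w) # vs) = c * \<phi> (v # vs) + \<phi> (w # vs)"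
  using multilinD[of \<phi> "[]"] by simp

lemma multilin_add: "multilin \<phi> \<Longrightarrow> \<phi> (us @ (v + w) # vs) = \<phi> (us @ v # vs) + \<phi> (us @ w # vs)"
  using multilinD[of \<phi> us 1 v w vs] by simp

lemma multilin_swap: assumes "multilin \<phi>" "altern \<phi>" shows "\<phi> (us @ a # b # vs) = - \<phi> (us @ b # a # vs)"
proof -
  have "0 = \<phi> (us @ (a + b) # (a + b) # vs)" using assms by (simp add: altern_def)
  also have "\<dots> = \<phi> (us @ a # (a + b) # vs) + \<phi> (us @ b # (a + b) # vs)" by (rule multilin_add[OF assms(1)])
  also have "\<phi> (us @ a # (a + b) # vs) = \<phi> (us @ a # a # vs) + \<phi> (us @ a # b # vs)"
    using multilin_add[OF assms(1), of "us @ [a]"] by simp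
  also have "\<phi> (us @ b # (a + b) # vs) = \<phi> (us @ b # a # vs) + \<phi> (us @ b # b # vs)"
    using multilin_add[OF assms(1), of "us @ [b]"] by simp
  finally show ?thesis using assms(2) by (simp add: altern_def)
qed

lemma multilin_not_distinct: assumes "multilin \<phi>" "altern \<phi>" "\<not> distinct vs" shows "\<phi> vs = 0"
proof -
  have "\<phi> (us @ v # ws @ v # zs) = 0" for us v ws zs
  proof (induction ws arbitrary: us)
    case Nil then show ?case using assms(2) by (simp add: altern_def)
  next
    case (Cons w ws)
    show ?case using multilin_swap[OF assms(1,2), of us v w "ws @ v # zs"] Cons[of "us @ [w]"] by simp
  qed
  then show ?thesis using not_distinct_decomp[OF assms(3)] by force
qed

context prolongation_chart
begin

lemma fst_U: "p \<in> W \<Longrightarrow> fst p \<in> U" using W_base by auto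

lemma basis_section_sections: "basis_section U \<alpha> \<in> lie_sections U"
  unfolding lie_sections_def
  using smooth_cong[OF open_base smooth_const[OF open_base], of "axis \<alpha> 1" "basis_section U \<alpha>"]
  by (auto simp: basis_section_def)

lemma bracket_coeff_smooth: "smooth_on W (\<lambda>p. bracket_coeff U br \<gamma> \<alpha> \<beta> (fst p))"
proof -
  have "smooth_on U (br (basis_section U \<alpha>) (basis_section U \<beta>))"
    using br_closed[OF basis_section_sections basis_section_sections] by (simp add: lie_sections_def)
  from smooth_fst[OF W_open open_base _ smooth_nth[OF open_base this]] show ?thesis
    using W_base by (simp add: bracket_coeff_def)
qed

lemma bracket_coeff_antisym: "bracket_coeff U br \<gamma> \<beta> \<alpha> x = - bracket_coeff U br \<gamma> \<alpha> \<beta> x"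
  unfolding bracket_coeff_def
  by (subst br_antisym[OF basis_section_sections basis_section_sections]) simp

lemma anchor_smooth_W: "smooth_on W (\<lambda>p. \<rho> (fst p) a $ i)"
  using smooth_fst[OF W_open open_base _ smooth_nth[OF open_base anchor_smooth]] W_base by simp

lemma ell_lin2: "structure_at p \<gamma> c (k *\<^sub>R v + w) = k * structure_at p \<gamma> c v + structure_at p \<gamma> c w"
  by (simp add: structure_at_def algebra_simps sum.distrib sum_distrib_left)
lemma ell_lin1: "structure_at p \<gamma> (k *\<^sub>R v + w) c = k * structure_at p \<gamma> v c + structure_at p \<gamma> w c"
  by (simp add: structure_at_def algebra_simps sum.distrib sum_distrib_left)
lemma ell_antisym: "structure_at p \<gamma> c' c = - structure_at p \<gamma> c c'"
proof -
  have "structure_at p \<gamma> c' c = (\<Sum>\<beta>\<in>UNIV. \<Sum>\<alpha>\<in>UNIV. bracket_coeff U br \<gamma> \<alpha> \<beta> (fst p) * (fst c' $ \<alpha> * fst c $ \<beta>))"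
    unfolding structure_at_def by (rule sum.swap)
  also have "\<dots> = (\<Sum>\<beta>\<in>UNIV. \<Sum>\<alpha>\<in>UNIV. - (bracket_coeff U br \<gamma> \<beta> \<alpha> (fst p) * (fst c $ \<beta> * fst c' $ \<alpha>)))"
    by (subst bracket_coeff_antisym) (simp add: mult_ac)
  finally show ?thesis by (simp add: structure_at_def sum_negf)
qed
lemma ell_self: "structure_at p \<gamma> c c = 0" using ell_antisym[of p \<gamma> c c] by simp
lemma ell_smooth: "smooth_on W (\<lambda>p. structure_at p \<gamma> c c')"
  unfolding structure_at_def by (intro smooth_sum smooth_mult W_open bracket_coeff_smooth smooth_const)

lemma brk_zero: "slot_bracket p c cs (\<lambda>us. 0) = 0" by (induction cs) auto

lemma brk_lin1: "slot_bracket p (k *\<^sub>R v + w) cs \<phi> = k * slot_bracket p v cs \<phi> + slot_bracket p w cs \<phi>"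
  by (induction cs arbitrary: \<phi>) (simp_all add: ell_lin1 distrib_left distrib_right sum.distrib sum_distrib_left mult.assoc)

lemma brk_ml:
  "multilin \<phi> \<Longrightarrow> slot_bracket p c (us @ (k *\<^sub>R v + w) # vs) \<phi> = k * slot_bracket p c (us @ v # vs) \<phi> + slot_bracket p c (us @ w # vs) \<phi>"
proof (induction us arbitrary: \<phi>)
  case Nil
  have "(\<lambda>us. \<phi> ((k *\<^sub>R v + w) # us)) = (\<lambda>us. k * \<phi> (v # us) + \<phi> (w # us))"
    by (rule ext) (rule multilinD0[OF Nil])
  then show ?case by (simp add: brk_lin ell_lin2 distrib_left distrib_right sum.distrib sum_distrib_left mult.assoc)
next
  case (Cons u us)
  have "\<phi> ((axis \<gamma> 1, 0) # us @ (k *\<^sub>R v + w) # vs) =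
     k * \<phi> ((axis \<gamma> 1, 0) # us @ v # vs) + \<phi> ((axis \<gamma> 1, 0) # us @ w # vs)" for \<gamma>
    using multilinD[OF Cons.prems, of "(axis \<gamma> 1, 0) # us"] by simp
  then show ?case using Cons.IH[OF multilin_Cons[OF Cons.prems, of u]]
    by (simp add: distrib_left sum.distrib sum_distrib_left mult_ac)
qed

lemma brk_ad: "multilin \<phi> \<Longrightarrow> altern \<phi> \<Longrightarrow> slot_bracket p c (us @ v # v # vs) \<phi> = 0"
proof (induction us arbitrary: \<phi>)
  case Nil
  have "(\<lambda>us. \<phi> (v # v # us)) = (\<lambda>us. 0)"
  proof (rule ext)
    fix us have "\<phi> ([] @ v # v # us) = 0" using Nil(2) unfolding altern_def by blast
    then show "\<phi> (v # v # us) = 0" by simp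
  qed
  moreover have "\<phi> (v # (axis \<gamma> 1, 0) # vs) = - \<phi> ((axis \<gamma> 1, 0) # v # vs)" for \<gamma>
    using multilin_swap[OF Nil, of "[]" v "(axis \<gamma> 1, 0)" vs] by simp
  ultimately show ?case by (simp add: brk_zero sum_negf)
next
  case (Cons u us)
  have "\<phi> ((axis \<gamma> 1, 0) # us @ v # v # vs) = 0" for \<gamma>
  proof -
    have "\<phi> (((axis \<gamma> 1, 0) # us) @ v # v # vs) = 0" using Cons.prems(2) unfolding altern_def by blast
    then show ?thesis by simp
  qed
  then show ?case using Cons.IH[OF multilin_Cons[OF Cons.prems(1)] altern_Cons[OF Cons.prems(2)]] by simp
qed

lemma anch_lin: "p \<in> W \<Longrightarrow> anchor_at p (k *\<^sub>R v + w) = k *\<^sub>R anchor_at p v + anchor_at p w"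
  using anchor_linear[OF fst_U] by (auto simp: anchor_at_def linear_add linear_scale)

lemma fd_linear:
  assumes "f differentiable (at p)"
  shows "frechet_derivative f (at p) (k *\<^sub>R v + w) = k *\<^sub>R frechet_derivative f (at p) v + frechet_derivative f (at p) w"
  using linear_frechet_derivative[OF assms] by (simp add: linear_add linear_scale)

lemma dt_ml:
  assumes p: "p \<in> W"
  shows "coeff_diff \<omega> \<Longrightarrow> (\<And>q. q \<in> W \<Longrightarrow> multilin (\<omega> q)) \<Longrightarrow>
    triv_d (us @ (k *\<^sub>R v + w) # vs) \<omega> p = k * triv_d (us @ v # vs) \<omega> p + triv_d (us @ w # vs) \<omega> p"
proof (induction us arbitrary: \<omega>)
  case Nil
  have "triv_lie (k *\<^sub>R v + w) \<omega> p vs = k * triv_lie v \<omega> p vs + triv_lie w \<omega> p vs"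
    using Nil(1) p by (simp add: triv_lie_def anch_lin brk_lin1 fd_linear coeff_diff_def right_diff_distrib)
  moreover have "triv_d vs (\<lambda>q us. \<omega> q ((k *\<^sub>R v + w) # us)) p = triv_d vs (\<lambda>q us. k * \<omega> q (v # us) + \<omega> q (w # us)) p"
    by (rule dt_cong[OF p]) (simp add: multilinD0 Nil)
  ultimately show ?case using p by (simp add: dt_lin D_Cons[OF Nil(1)] right_diff_distrib)
next
  case (Cons u us)
  let ?z = "us @ (k *\<^sub>R v + w) # vs"
  have "frechet_derivative (\<lambda>q. \<omega> q ?z) (at p) = frechet_derivative (\<lambda>q. k * \<omega> q (us @ v # vs) + \<omega> q (us @ w # vs)) (at p)"
    by (rule fd_W_cong[OF p]) (simp add: multilinD Cons.prems)
  then have "triv_lie u \<omega> p ?z = k * triv_lie u \<omega> p (us @ v # vs) + triv_lie u \<omega> p (us @ w # vs)"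
    using Cons.prems p by (simp add: triv_lie_def fd_lin coeff_diff_def brk_ml right_diff_distrib)
  moreover have "triv_d ?z (\<lambda>q us. \<omega> q (u # us)) p
      = k * triv_d (us @ v # vs) (\<lambda>q us. \<omega> q (u # us)) p + triv_d (us @ w # vs) (\<lambda>q us. \<omega> q (u # us)) p"
    by (rule Cons.IH) (auto intro: D_Cons multilin_Cons Cons.prems)
  ultimately show ?case by (simp add: right_diff_distrib)
qed

lemma dt_ad:
  assumes p: "p \<in> W"
  shows "coeff_diff \<omega> \<Longrightarrow> (\<And>q. q \<in> W \<Longrightarrow> multilin (\<omega> q)) \<Longrightarrow> (\<And>q. q \<in> W \<Longrightarrow> altern (\<omega> q)) \<Longrightarrow>
    triv_d (us @ v # v # vs) \<omega> p = 0"
proof (induction us arbitrary: \<omega>)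
  case Nil
  have "triv_d vs (\<lambda>q us. \<omega> q (v # v # us)) p = 0"
  proof (rule dt_eq_zero[OF p])
    fix q us assume "q \<in> W"
    from Nil(3)[OF this] have "\<omega> q ([] @ v # v # us) = 0" unfolding altern_def by blast
    then show "\<omega> q (v # v # us) = 0" by simp
  qed
  then show ?case by (simp add: triv_lie_def ell_self)
next
  case (Cons u us)
  let ?z = "us @ v # v # vs"
  have "\<omega> q ?z = 0" if "q \<in> W" for q using Cons.prems(3)[OF that] by (simp only: altern_def)
  then have "frechet_derivative (\<lambda>q. \<omega> q ?z) (at p) = frechet_derivative (\<lambda>q. 0) (at p)"
    by (rule fd_W_cong[OF p])
  then have "triv_lie u \<omega> p ?z = 0" by (simp add: triv_lie_def brk_ad[OF Cons.prems(2,3)[OF p]])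
  moreover have "triv_d ?z (\<lambda>q us. \<omega> q (u # us)) p = 0"
    by (rule Cons.IH) (auto intro: D_Cons multilin_Cons altern_Cons Cons.prems)
  ultimately show ?case by simp
qed

lemma brk_smooth: "(\<And>cs. smooth_on W (\<lambda>p. \<omega> p cs)) \<Longrightarrow> smooth_on W (\<lambda>p. slot_bracket p c cs (\<omega> p))"
proof (induction cs arbitrary: \<omega>)
  case Nil then show ?case by (simp add: smooth_const W_open)
next
  case (Cons v vs)
  have "smooth_on W (\<lambda>p. slot_bracket p c vs (\<lambda>us. \<omega> p (v # us)))" by (rule Cons.IH) (rule Cons.prems)
  then show ?case unfolding slot_bracket.simps
    by (rule smooth_add[OF W_open smooth_sum[OF W_open smooth_mult[OF W_open ell_smooth Cons.prems]]])
qed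

lemma vec_expand: "(\<Sum>i\<in>UNIV. (u $ i) *\<^sub>R axis i 1) = (u :: real^'n)"
  by (simp add: vec_eq_iff axis_def if_distrib cong: if_cong)

lemma pair_expand: "((u::real^'m), (w::real^'r)) = (\<Sum>i\<in>UNIV. (u $ i) *\<^sub>R (axis i 1, 0)) + (0, w)"
  by (rule prod_eqI) (simp_all only: fst_add snd_add fst_sum snd_sum fst_conv snd_conv fst_scaleR snd_scaleR vec_expand scaleR_zero_right sum.neutral_const add_0 add_0_right)

lemma fd_expand:
  fixes f :: "(real^'m) \<times> (real^'r) \<Rightarrow> real"
  assumes "f differentiable (at p)"
  shows "frechet_derivative f (at p) (u, w)
    = (\<Sum>i\<in>UNIV. u $ i * frechet_derivative f (at p) (axis i 1, 0)) + frechet_derivative f (at p) (0, w)"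
proof -
  note l = linear_frechet_derivative[OF assms]
  show ?thesis
    by (subst pair_expand) (simp only: linear_add[OF l] linear_sum[OF l] linear_scale[OF l] real_scaleR_def)
qed

lemma dt_smooth: "(\<And>cs. smooth_on W (\<lambda>p. \<omega> p cs)) \<Longrightarrow> smooth_on W (\<lambda>p. triv_d cs \<omega> p)"
proof (induction cs arbitrary: \<omega>)
  case Nil then show ?case by (simp add: smooth_const W_open)
next
  case (Cons c cs)
  let ?F = "\<lambda>v p. frechet_derivative (\<lambda>q. \<omega> q cs) (at p) v"
  have "smooth_on W (\<lambda>p. (\<Sum>i\<in>UNIV. \<rho> (fst p) (fst c) $ i * ?F (axis i 1, 0) p) + ?F (0, snd c) p)"
    by (intro smooth_add smooth_sum smooth_mult W_open anchor_smooth_W smooth_fd Cons.prems)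
  then have "smooth_on W (\<lambda>p. ?F (anchor_at p c) p)"
    by (rule smooth_cong[OF W_open])
      (simp add: anchor_at_def fd_expand[OF smooth_differentiable[OF Cons.prems], symmetric])
  then have "smooth_on W (\<lambda>p. triv_lie c \<omega> p cs)"
    unfolding triv_lie_def by (intro smooth_diff W_open brk_smooth Cons.prems)
  moreover have "smooth_on W (triv_d cs (\<lambda>q us. \<omega> q (c # us)))" by (rule Cons.IH) (rule Cons.prems)
  ultimately show ?case by (simp add: smooth_diff W_open)
qed

abbreviation "fibre \<equiv> prolongation_fibre \<rho>"
abbreviation "lift \<equiv> prolongation_elem \<rho>"

definition trivialize :: "('a, 'm, 'r) pvec \<Rightarrow> (real^'a) \<times> (real^'r)" where "trivialize v = (fst v, snd (snd v))"
definition triv_form :: "('a, 'm, 'r) form \<Rightarrow> (real^'m) \<times> (real^'r) \<Rightarrow> ((real^'a) \<times> (real^'r)) list \<Rightarrow> real" where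
  "triv_form \<omega> q us = \<omega> q (map (lift q) us)"
definition normalized :: "('a, 'm, 'r) form \<Rightarrow> bool" where
  "normalized \<omega> \<longleftrightarrow> (\<forall>p vs. p \<notin> W \<or> \<not> set vs \<subseteq> fibre p \<longrightarrow> \<omega> p vs = 0)"
definition ext_d :: "('a, 'm, 'r) form \<Rightarrow> ('a, 'm, 'r) form" where
  "ext_d \<omega> p vs = (if p \<in> W \<and> set vs \<subseteq> fibre p then triv_d (map trivialize vs) (triv_form \<omega>) p else 0)"

lemma elem_fib: "lift p c \<in> fibre p" by (simp add: prolongation_elem_def prolongation_fibre_def)
lemma map_elem_fib: "set (map (lift p) cs) \<subseteq> fibre p" by (auto intro: elem_fib)
lemma pr_elem: "trivialize (lift p c) = c" by (simp add: prolongation_elem_def trivialize_def)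
lemma map_pr_elem: "map trivialize (map (lift p) cs) = cs" by (simp add: pr_elem o_def)
lemma elem_pr: "v \<in> fibre p \<Longrightarrow> lift p (trivialize v) = v"
  by (auto simp: prolongation_elem_def trivialize_def prolongation_fibre_def)
lemma map_elem_pr: "set vs \<subseteq> fibre p \<Longrightarrow> map (lift p) (map trivialize vs) = vs"
  by (induction vs) (auto simp: elem_pr)
lemma tr_pr: "set vs \<subseteq> fibre p \<Longrightarrow> triv_form \<omega> p (map trivialize vs) = \<omega> p vs"
  by (simp only: triv_form_def map_elem_pr)

lemma tr_ext_d: "q \<in> W \<Longrightarrow> triv_form (ext_d \<omega>) q us = triv_d us (triv_form \<omega>) q"
  using map_elem_fib[of q us] map_pr_elem[of q us] by (simp only: triv_form_def ext_d_def simp_thms if_True)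

lemma form_eqI: 
  assumes "normalized \<omega>" "normalized \<eta>" "\<And>q us. q \<in> W \<Longrightarrow> triv_form \<omega> q us = triv_form \<eta> q us"
  shows "\<omega> = \<eta>"
proof (intro ext)
  fix p vs show "\<omega> p vs = \<eta> p vs"
  proof (cases "p \<in> W \<and> set vs \<subseteq> fibre p")
    case True then show ?thesis using assms(3)[of p "map trivialize vs"] by (simp only: tr_pr)
  next
    case False then show ?thesis using assms(1,2) unfolding normalized_def by metis
  qed
qed

lemma normal_ext_d: "normalized (ext_d \<omega>)" by (auto simp: normalized_def ext_d_def)

lemma elem_lin: "p \<in> W \<Longrightarrow> lift p (k *\<^sub>R v + w) = k *\<^sub>R lift p v + lift p w"
  using anchor_linear[OF fst_U] by (auto simp: prolongation_elem_def linear_add linear_scale)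
lemma pr_lin: "trivialize (k *\<^sub>R v + w) = k *\<^sub>R trivialize v + trivialize w" by (simp add: trivialize_def)
lemma fib_lin:
  assumes "p \<in> W" "v \<in> fibre p" "w \<in> fibre p"
  shows "k *\<^sub>R v + w \<in> fibre p"
proof -
  have l: "linear (\<rho> (fst p))" using assms(1) by (rule anchor_linear[OF fst_U])
  show ?thesis using assms by (auto simp: prolongation_fibre_def linear_add[OF l] linear_scale[OF l])
qed

lemma alt_tr:
  assumes p: "p \<in> W"
  shows "alternating_multilinear_on (fibre p) (\<omega> p) \<longleftrightarrow> multilin (triv_form \<omega> p) \<and> altern (triv_form \<omega> p)"
proof
  assume a: "alternating_multilinear_on (fibre p) (\<omega> p)"
  have "triv_form \<omega> p (us @ (c *\<^sub>R v + w) # vs) = c * triv_form \<omega> p (us @ v # vs) + triv_form \<omega> p (us @ w # vs)" for us v w vs c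
    using a map_elem_fib[of p us] map_elem_fib[of p vs] elem_fib[of p v] elem_fib[of p w] p
    unfolding alternating_multilinear_on_def triv_form_def map_append list.map elem_lin[OF p] by blast
  moreover have "triv_form \<omega> p (us @ v # v # vs) = 0" for us v vs
  proof -
    have "\<not> distinct (map (lift p) (us @ v # v # vs))" by simp
    then show ?thesis using a map_elem_fib[of p "us @ v # v # vs"]
      unfolding alternating_multilinear_on_def triv_form_def by blast
  qed
  ultimately show "multilin (triv_form \<omega> p) \<and> altern (triv_form \<omega> p)" by (simp add: multilin_def altern_def)
next
  assume a: "multilin (triv_form \<omega> p) \<and> altern (triv_form \<omega> p)"
  have "\<omega> p (us @ (c *\<^sub>R v + w) # vs) = c * \<omega> p (us @ v # vs) + \<omega> p (us @ w # vs)"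
    if s: "set us \<subseteq> fibre p" "v \<in> fibre p" "w \<in> fibre p" "set vs \<subseteq> fibre p" for us v w vs c
  proof -
    have "\<omega> p (us @ (c *\<^sub>R v + w) # vs) = triv_form \<omega> p (map trivialize (us @ (c *\<^sub>R v + w) # vs))"
      by (rule tr_pr[symmetric]) (use s fib_lin[OF p] in auto)
    also have "\<dots> = c * triv_form \<omega> p (map trivialize (us @ v # vs)) + triv_form \<omega> p (map trivialize (us @ w # vs))"
      using a by (simp add: pr_lin multilinD)
    also have "triv_form \<omega> p (map trivialize (us @ v # vs)) = \<omega> p (us @ v # vs)" by (rule tr_pr) (use s in auto)
    also have "triv_form \<omega> p (map trivialize (us @ w # vs)) = \<omega> p (us @ w # vs)" by (rule tr_pr) (use s in auto)
    finally show ?thesis .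
  qed
  moreover have "\<omega> p vs = 0" if s: "set vs \<subseteq> fibre p" "\<not> distinct vs" for vs
  proof -
    have "\<not> distinct (map trivialize vs)"
      using s by (metis distinct_map map_elem_pr)
    then show ?thesis using multilin_not_distinct a tr_pr[OF s(1)] by metis
  qed
  ultimately show "alternating_multilinear_on (fibre p) (\<omega> p)" unfolding alternating_multilinear_on_def by blast
qed

lemma forms_tr: "\<omega> \<in> forms \<rho> W \<longleftrightarrow>
   normalized \<omega> \<and> (\<forall>p\<in>W. multilin (triv_form \<omega> p) \<and> altern (triv_form \<omega> p)) \<and> (\<forall>cs. smooth_on W (\<lambda>p. triv_form \<omega> p cs))"
  unfolding forms_def normalized_def triv_form_def[symmetric] using alt_tr by auto

lemma forms_D: "\<omega> \<in> forms \<rho> W \<Longrightarrow> coeff_diff (triv_form \<omega>)"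
  by (auto simp: forms_tr coeff_diff_def intro: smooth_differentiable)

lemma ext_d_forms: assumes "\<omega> \<in> forms \<rho> W" shows "ext_d \<omega> \<in> forms \<rho> W"
proof -
  have f: "\<And>p. p \<in> W \<Longrightarrow> multilin (triv_form \<omega> p)" "\<And>p. p \<in> W \<Longrightarrow> altern (triv_form \<omega> p)" "\<And>cs. smooth_on W (\<lambda>p. triv_form \<omega> p cs)"
    using assms by (auto simp: forms_tr)
  note d = forms_D[OF assms]
  have "multilin (triv_form (ext_d \<omega>) p) \<and> altern (triv_form (ext_d \<omega>) p)" if "p \<in> W" for p
    using dt_ml[OF that d f(1)] dt_ad[OF that d f(1,2)] that by (simp add: multilin_def altern_def tr_ext_d)
  moreover have "smooth_on W (\<lambda>p. triv_form (ext_d \<omega>) p cs)" for cs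
    by (rule smooth_cong[OF W_open dt_smooth[where \<omega>="triv_form \<omega>" and cs=cs]]) (simp_all add: f tr_ext_d)
  ultimately show ?thesis by (simp add: forms_tr normal_ext_d)
qed

lemma ext_d_degree: assumes "\<omega> \<in> forms_of_degree q \<rho> W" shows "ext_d \<omega> \<in> forms_of_degree (Suc q) \<rho> W"
proof -
  have w: "\<omega> \<in> forms \<rho> W" "\<And>p vs. length vs \<noteq> q \<Longrightarrow> \<omega> p vs = 0" using assms by (auto simp: forms_of_degree_def)
  have "ext_d \<omega> p vs = 0" if "length vs \<noteq> Suc q" for p vs
    using that by (auto simp: ext_d_def intro!: dt_eq_zero w simp: triv_form_def)
  then show ?thesis using ext_d_forms[OF w(1)] by (simp add: forms_of_degree_def)
qed

lemma normal_wedge: assumes "normalized \<omega>" "normalized \<eta>" shows "normalized (\<omega> \<^bold>\<and> \<eta>)"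
  unfolding normalized_def
proof (intro allI impI)
  fix p vs assume a: "p \<notin> W \<or> \<not> set vs \<subseteq> fibre p"
  have "\<omega> p (nths vs S) = 0 \<or> \<eta> p (nths vs (- S)) = 0" for S
  proof (cases "p \<in> W")
    case True
    have "set vs \<subseteq> set (nths vs S) \<union> set (nths vs (- S))"
    proof
      fix v assume "v \<in> set vs"
      then obtain i where "i < length vs" "v = vs ! i" by (auto simp: in_set_conv_nth)
      then show "v \<in> set (nths vs S) \<union> set (nths vs (- S))" by (cases "i \<in> S") (auto simp: set_nths)
    qed
    then show ?thesis using a True assms unfolding normalized_def by (meson Un_least order_trans)
  next
    case False then show ?thesis using assms unfolding normalized_def by blast
  qed
  then show "(\<omega> \<^bold>\<and> \<eta>) p vs = 0" unfolding wedge_def by (intro sum.neutral) auto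
qed

lemma normal_lin: "normalized \<omega> \<Longrightarrow> normalized \<eta> \<Longrightarrow> normalized (\<lambda>p vs. k p * \<omega> p vs + \<eta> p vs)"
  by (auto simp: normalized_def)

lemma tr_wedge: "triv_form (\<omega> \<^bold>\<and> \<eta>) q = list_wedge (triv_form \<omega> q) (triv_form \<eta> q)"
  by (rule ext) (simp add: triv_form_def[abs_def] wedge_wl wl_map)

lemma forms_normal: "\<omega> \<in> forms \<rho> W \<Longrightarrow> normalized \<omega>" by (simp add: forms_tr)

lemma ext_d_leibniz:
  assumes w: "\<omega> \<in> forms_of_degree q \<rho> W" and e: "\<eta> \<in> forms \<rho> W"
  shows "ext_d (\<omega> \<^bold>\<and> \<eta>) = (\<lambda>p vs. (ext_d \<omega> \<^bold>\<and> \<eta>) p vs + (- 1) ^ q * (\<omega> \<^bold>\<and> ext_d \<eta>) p vs)"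
proof (rule form_eqI)
  have w': "\<omega> \<in> forms \<rho> W" "\<And>p vs. length vs \<noteq> q \<Longrightarrow> \<omega> p vs = 0" using w by (auto simp: forms_of_degree_def)
  show "normalized (\<lambda>p vs. (ext_d \<omega> \<^bold>\<and> \<eta>) p vs + (- 1) ^ q * (\<omega> \<^bold>\<and> ext_d \<eta>) p vs)"
    using normal_lin[OF normal_wedge[OF forms_normal[OF w'(1)] normal_ext_d[of \<eta>]]
        normal_wedge[OF normal_ext_d[of \<omega>] forms_normal[OF e]], of "\<lambda>p. (-1)^q"] by (simp add: add.commute)
  fix p us assume p: "p \<in> W"
  have g: "grade_inv (triv_form \<omega> p) = (\<lambda>us. (-1) ^ q * triv_form \<omega> p us + 0)"
  proof (rule ext)
    fix us show "grade_inv (triv_form \<omega> p) us = (-1) ^ q * triv_form \<omega> p us + 0"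
      by (cases "length us = q") (simp_all add: grade_inv_def triv_form_def w'(2))
  qed
  have t: "triv_form (ext_d \<omega>) p = (\<lambda>us. triv_d us (triv_form \<omega>) p)" "triv_form (ext_d \<eta>) p = (\<lambda>us. triv_d us (triv_form \<eta>) p)"
    by (auto simp: tr_ext_d p)
  have "triv_form (ext_d (\<omega> \<^bold>\<and> \<eta>)) p us = triv_d us (\<lambda>q. list_wedge (triv_form \<omega> q) (triv_form \<eta> q)) p"
    using p by (simp add: tr_ext_d tr_wedge[abs_def])
  also have "\<dots> = list_wedge (\<lambda>us. triv_d us (triv_form \<omega>) p) (triv_form \<eta> p) us + list_wedge (grade_inv (triv_form \<omega> p)) (\<lambda>us. triv_d us (triv_form \<eta>) p) us"
    by (rule dt_wl[OF p forms_D[OF w'(1)] forms_D[OF e]])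
  also have "\<dots> = triv_form (ext_d \<omega> \<^bold>\<and> \<eta>) p us + (-1) ^ q * triv_form (\<omega> \<^bold>\<and> ext_d \<eta>) p us"
    unfolding g wl_linear_left tr_wedge t by (simp add: list_wedge_def)
  finally show "triv_form (ext_d (\<omega> \<^bold>\<and> \<eta>)) p us =
       triv_form (\<lambda>p vs. (ext_d \<omega> \<^bold>\<and> \<eta>) p vs + (- 1) ^ q * (\<omega> \<^bold>\<and> ext_d \<eta>) p vs) p us"
    by (simp add: triv_form_def)
qed (rule normal_ext_d)

lemma ext_d_lin:
  assumes "\<omega> \<in> forms \<rho> W" "\<eta> \<in> forms \<rho> W"
  shows "ext_d (\<lambda>p vs. c * \<omega> p vs + \<eta> p vs) = (\<lambda>p vs. c * ext_d \<omega> p vs + ext_d \<eta> p vs)"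
proof (intro ext)
  fix p vs
  have "triv_form (\<lambda>p vs. c * \<omega> p vs + \<eta> p vs) = (\<lambda>q us. c * triv_form \<omega> q us + triv_form \<eta> q us)" by (intro ext) (simp add: triv_form_def)
  then show "ext_d (\<lambda>p vs. c * \<omega> p vs + \<eta> p vs) p vs = c * ext_d \<omega> p vs + ext_d \<eta> p vs"
    using assms by (simp add: ext_d_def dt_lin forms_D)
qed

lemma normal_coframes: "normalized (coframe_e \<rho> W \<alpha>)" "normalized (coframe_E \<rho> W \<mu>)" "normalized (fun_form W f)"
  by (auto simp: normalized_def coframe_e_def coframe_E_def fun_form_def)

lemma normal_one_form: "normalized (one_form \<rho> W \<theta> \<phi>)"
  using normal_coframes unfolding normalized_def one_form_def by simp

lemma tr_coframe_e: "q \<in> W \<Longrightarrow> triv_form (coframe_e \<rho> W \<alpha>) q us = (if length us = 1 then fst (hd us) $ \<alpha> else 0)"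
  using map_elem_fib[of q us] by (cases us) (auto simp: triv_form_def coframe_e_def prolongation_elem_def)
lemma tr_coframe_E: "q \<in> W \<Longrightarrow> triv_form (coframe_E \<rho> W \<mu>) q us = (if length us = 1 then snd (hd us) $ \<mu> else 0)"
  using map_elem_fib[of q us] by (cases us) (auto simp: triv_form_def coframe_E_def prolongation_elem_def)
lemma tr_fun_form: "q \<in> W \<Longrightarrow> triv_form (fun_form W f) q us = (if us = [] then f q else 0)"
  by (simp add: triv_form_def fun_form_def)

lemma anchor_expand: "p \<in> W \<Longrightarrow> \<rho> (fst p) a $ i = (\<Sum>\<alpha>\<in>UNIV. anchor_coeff \<rho> i \<alpha> (fst p) * a $ \<alpha>)"
proof -
  assume "p \<in> W"
  then have l: "linear (\<rho> (fst p))" by (rule anchor_linear[OF fst_U])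
  have "\<rho> (fst p) a = \<rho> (fst p) (\<Sum>\<alpha>\<in>UNIV. a $ \<alpha> *\<^sub>R axis \<alpha> 1)" by (simp only: vec_expand)
  also have "\<dots> = (\<Sum>\<alpha>\<in>UNIV. a $ \<alpha> *\<^sub>R \<rho> (fst p) (axis \<alpha> 1))" using l by (simp add: linear_sum linear_scale)
  finally show ?thesis by (simp add: anchor_coeff_def mult.commute)
qed

lemma fd_expand_y:
  fixes f :: "(real^'m) \<times> (real^'r) \<Rightarrow> real"
  assumes "f differentiable (at p)"
  shows "frechet_derivative f (at p) (0, w) = (\<Sum>\<mu>\<in>UNIV. w $ \<mu> * frechet_derivative f (at p) (0, axis \<mu> 1))"
proof -
  have "(0::real^'m, w) = (\<Sum>\<mu>\<in>UNIV. w $ \<mu> *\<^sub>R (0, axis \<mu> 1))"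
    by (rule prod_eqI) (simp_all only: fst_add snd_add fst_sum snd_sum fst_conv snd_conv fst_scaleR snd_scaleR vec_expand scaleR_zero_right sum.neutral_const add_0 add_0_right)
  then show ?thesis
    by (simp only: linear_sum[OF linear_frechet_derivative[OF assms]] linear_scale[OF linear_frechet_derivative[OF assms]] real_scaleR_def)
qed

lemma fd_0: "frechet_derivative (\<lambda>q. c) (at p) v = 0" by simp

lemma ext_d_fun:
  assumes f: "smooth_on W f"
  shows "ext_d (fun_form W f) =
     one_form \<rho> W (\<lambda>\<alpha> p. \<Sum>i\<in>UNIV. anchor_coeff \<rho> i \<alpha> (fst p) * partial_x i f p) (\<lambda>\<mu>. partial_y \<mu> f)"
proof (rule form_eqI)
  fix p us assume p: "p \<in> W"
  have fd: "f differentiable (at p)" by (rule smooth_differentiable[OF f p])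
  show "triv_form (ext_d (fun_form W f)) p us = triv_form (one_form \<rho> W (\<lambda>\<alpha> p. \<Sum>i\<in>UNIV. anchor_coeff \<rho> i \<alpha> (fst p) * partial_x i f p)
           (\<lambda>\<mu>. partial_y \<mu> f)) p us" (is "_ = triv_form ?R p us")
  proof (cases "length us = 1")
    case False
    have "triv_d us (triv_form (fun_form W f)) p = 0"
      by (rule dt_eq_zero[OF p]) (use False in \<open>auto simp: tr_fun_form\<close>)
    moreover have "triv_form ?R p us = 0"
      using False tr_coframe_e[OF p, of _ us] tr_coframe_E[OF p, of _ us] by (simp add: triv_form_def one_form_def)
    ultimately show ?thesis by (simp add: tr_ext_d p)
  next
    case True
    then obtain c where us: "us = [c]" by (auto simp: length_Suc_conv)
    have "frechet_derivative (\<lambda>q. triv_form (fun_form W f) q []) (at p) = frechet_derivative f (at p)"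
      by (rule fd_W_cong[OF p]) (simp add: tr_fun_form)
    then have "triv_form (ext_d (fun_form W f)) p us = frechet_derivative f (at p) (anchor_at p c)"
      by (simp add: tr_ext_d p us triv_lie_def)
    also have "\<dots> = (\<Sum>i\<in>UNIV. \<rho> (fst p) (fst c) $ i * partial_x i f p) + (\<Sum>\<mu>\<in>UNIV. snd c $ \<mu> * partial_y \<mu> f p)"
      by (simp only: anchor_at_def fd_expand[OF fd, of "\<rho> (fst p) (fst c)"] fd_expand_y[OF fd, of "snd c"] partial_x_def partial_y_def)
    also have "(\<Sum>i\<in>UNIV. \<rho> (fst p) (fst c) $ i * partial_x i f p)
       = (\<Sum>\<alpha>\<in>UNIV. (\<Sum>i\<in>UNIV. anchor_coeff \<rho> i \<alpha> (fst p) * partial_x i f p) * fst c $ \<alpha>)"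
      unfolding anchor_expand[OF p] sum_distrib_right by (rule trans[OF sum.swap]) (simp add: mult_ac)
    also have "\<dots> + (\<Sum>\<mu>\<in>UNIV. snd c $ \<mu> * partial_y \<mu> f p) = triv_form ?R p us"
      using tr_coframe_e[OF p, of _ us] tr_coframe_E[OF p, of _ us] by (simp add: triv_form_def one_form_def us mult.commute)
    finally show ?thesis .
  qed
qed (rule normal_ext_d normal_one_form)+

lemma ext_d_coframe_E: "ext_d (coframe_E \<rho> W \<mu>) = (\<lambda>p vs. 0)"
proof (rule form_eqI)
  show "normalized (\<lambda>p vs. 0)" by (simp add: normalized_def)
  fix p us assume p: "p \<in> W"
  have f: "frechet_derivative (\<lambda>q. triv_form (coframe_E \<rho> W \<mu>) q [c]) (at p) = frechet_derivative (\<lambda>q. snd c $ \<mu>) (at p)" for c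
    by (rule fd_W_cong[OF p]) (simp add: tr_coframe_E)
  show "triv_form (ext_d (coframe_E \<rho> W \<mu>)) p us = triv_form (\<lambda>p vs. 0) p us"
  proof (cases "length us = 2")
    case False
    have "triv_d us (triv_form (coframe_E \<rho> W \<mu>)) p = 0"
      by (rule dt_eq_zero[OF p]) (use False in \<open>auto simp: tr_coframe_E\<close>)
    then show ?thesis by (simp add: tr_ext_d p) (simp add: triv_form_def)
  next
    case True
    then obtain c d where us: "us = [c, d]" by (auto simp: numeral_2_eq_2 length_Suc_conv)
    show ?thesis by (simp add: tr_ext_d p us triv_lie_def f tr_coframe_E) (simp add: triv_form_def)
  qed
qed (rule normal_ext_d)

lemma ext_d_coframe_e: "ext_d (coframe_e \<rho> W \<alpha>) =
        (\<lambda>p vs. - (1 / 2) * (\<Sum>\<beta>\<in>UNIV. \<Sum>\<gamma>\<in>UNIV. bracket_coeff U br \<alpha> \<beta> \<gamma> (fst p) *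
                   (coframe_e \<rho> W \<beta> \<^bold>\<and> coframe_e \<rho> W \<gamma>) p vs))" (is "_ = ?R")
proof (rule form_eqI)
  show "normalized ?R" using normal_wedge[OF normal_coframes(1) normal_coframes(1)] by (simp add: normalized_def)
  fix p us assume p: "p \<in> W"
  have f: "frechet_derivative (\<lambda>q. triv_form (coframe_e \<rho> W \<alpha>) q [c]) (at p) = frechet_derivative (\<lambda>q. fst c $ \<alpha>) (at p)" for c
    by (rule fd_W_cong[OF p]) (simp add: tr_coframe_e)
  have R: "triv_form ?R p us = - (1 / 2) * (\<Sum>\<beta>\<in>UNIV. \<Sum>\<gamma>\<in>UNIV. bracket_coeff U br \<alpha> \<beta> \<gamma> (fst p) *
                   list_wedge (triv_form (coframe_e \<rho> W \<beta>) p) (triv_form (coframe_e \<rho> W \<gamma>) p) us)"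
    unfolding tr_wedge[symmetric] by (simp add: triv_form_def)
  show "triv_form (ext_d (coframe_e \<rho> W \<alpha>)) p us = triv_form ?R p us"
  proof (cases "length us = 2")
    case False
    have "triv_d us (triv_form (coframe_e \<rho> W \<alpha>)) p = 0"
      by (rule dt_eq_zero[OF p]) (use False in \<open>auto simp: tr_coframe_e\<close>)
    moreover have "list_wedge (triv_form (coframe_e \<rho> W \<beta>) p) (triv_form (coframe_e \<rho> W \<gamma>) p) us = 0" for \<beta> \<gamma>
      unfolding list_wedge_def
    proof (intro sum.neutral ballI)
      fix S assume "S \<in> Pow {..<length us}"
      have "length us = length (nths us S) + length (nths us (- S))"
      proof -
        have "{..<length us} = {i. i < length us \<and> i \<in> S} \<union> {i. i < length us \<and> i \<in> - S}" by auto
        then have "card {..<length us} = card {i. i < length us \<and> i \<in> S} + card {i. i < length us \<and> i \<in> - S}"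
          by (simp only:) (rule card_Un_disjoint, auto)
        then show ?thesis by (simp add: length_nths)
      qed
      then show "shuffle_sign (length us) S * triv_form (coframe_e \<rho> W \<beta>) p (nths us S) * triv_form (coframe_e \<rho> W \<gamma>) p (nths us (- S)) = 0"
        using False by (auto simp: tr_coframe_e p)
    qed
    ultimately show ?thesis by (simp only: R tr_ext_d p) simp
  next
    case True
    then obtain c d where us: "us = [c, d]" by (auto simp: numeral_2_eq_2 length_Suc_conv)
    have "triv_form (ext_d (coframe_e \<rho> W \<alpha>)) p us = - (\<Sum>\<gamma>\<in>UNIV. structure_at p \<gamma> c d * (axis \<gamma> 1 $ \<alpha>))"
      by (simp add: tr_ext_d p us triv_lie_def f tr_coframe_e)
    also have "(\<Sum>\<gamma>\<in>UNIV. structure_at p \<gamma> c d * (axis \<gamma> 1 $ \<alpha>)) = (\<Sum>\<gamma>\<in>UNIV. if \<gamma> = \<alpha> then structure_at p \<gamma> c d else 0)"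
      by (intro sum.cong refl) (auto simp: axis_def)
    also have "\<dots> = structure_at p \<alpha> c d" by simp
    also have "- structure_at p \<alpha> c d = - (1/2) * (structure_at p \<alpha> c d - structure_at p \<alpha> d c)" using ell_antisym[of p \<alpha> d c] by simp
    also have "\<dots> = triv_form ?R p us"
      unfolding R[unfolded us] us structure_at_def sum_subtractf[symmetric]
      by (intro arg_cong[where f="(*) (- (1/2))"] sum.cong refl)
        (simp add: tr_coframe_e p grade_inv_def right_diff_distrib mult_ac)
    finally show ?thesis .
  qed
qed (rule normal_ext_d)

theorem exterior_derivative_ext_d: "exterior_derivative U \<rho> br W ext_d"
  unfolding exterior_derivative_def
  using ext_d_degree ext_d_lin ext_d_leibniz ext_d_fun ext_d_coframe_e ext_d_coframe_E by blast

end

theorem exterior_derivative_exists: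
  assumes "lie_algebroid U \<rho> br" "open W" "fst ` W = U"
  shows "\<exists>\<delta>. exterior_derivative U \<rho> br W \<delta>"
proof -
  interpret prolongation_chart U \<rho> br W
    using assms by (simp add: prolongation_chart_def prolongation_chart_axioms_def)
  show ?thesis using exterior_derivative_ext_d by blast
qed

end

theory Submission
  imports Defs
begin

text \<open>
  Along the graph of a solution, every \<open>\<sigma>\<^sup>k\<close> vanishes on the vectors \<open>c\<^sub>\<alpha> = e\<^sub>\<alpha> + X\<^sub>\<alpha>(ybar\<^sup>\<mu>) E\<^sub>\<mu>\<close>,
  whose anchor is \<open>Y\<^sub>\<alpha>\<close>; hence so does every form in the ideal, and in particular
  \<open>\<delta>\<sigma>\<^sup>k(c\<^sub>\<alpha>, c\<^sub>\<beta>) = 0\<close>.  On one-forms \<open>\<delta>\<close> is given by Cartan's formula, which at \<open>(c\<^sub>\<alpha>, c\<^sub>\<beta>)\<close>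
  consists of the derivatives of the coefficients of \<open>\<sigma>\<^sup>k\<close> along \<open>Y\<^sub>\<alpha>\<close> and \<open>Y\<^sub>\<beta>\<close> and of the term
  \<open>- L\<^sup>\<gamma>\<^sub>\<alpha>\<^sub>\<beta> \<theta>\<^sup>k\<^sub>\<gamma>\<close>; up to sign this is the dependency condition.
\<close>

section \<open>Functions and one-forms as elements of the space of forms\<close>

lemma wl_scalar: "list_wedge (\<lambda>us. if us = [] then a else 0) \<psi> vs = a * \<psi> vs"
proof (induction vs arbitrary: \<psi>)
  case (Cons v vs)
  \<comment> \<open>In \<open>wl_Cons\<close> the first summand has left factor
    \<open>\<lambda>us. 0\<close>, since the scalar vanishes on nonempty lists. In the second the
    sign is +1 on the empty list, so the left factor keeps its shape and the induction goes
    through.\<close>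
  have "grade_inv (\<lambda>us. if us = [] then a else 0) = (\<lambda>us::'a list. if us = [] then a else 0)"
    by (auto simp: grade_inv_def)
  moreover have "list_wedge (\<lambda>us. 0) \<psi> vs = 0" by (simp add: list_wedge_def)
  ultimately show ?case by (simp add: Cons.IH)
qed simp

text \<open>In the list encoding a covector is a function supported on singletons. On longer lists
  all terms vanish, so only linearity of \<open>l\<close> is left.\<close>

lemma multilin_single:
  assumes "linear l"
  shows "multilin (\<lambda>us. if length us = 1 then l (hd us) else 0)"
  unfolding multilin_def
proof (intro allI)
  fix us v w vs c
  show "(if length (us @ (c *\<^sub>R v + w) # vs) = 1 then l (hd (us @ (c *\<^sub>R v + w) # vs)) else 0) =
      c * (if length (us @ v # vs) = 1 then l (hd (us @ v # vs)) else 0) +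
      (if length (us @ w # vs) = 1 then l (hd (us @ w # vs)) else 0)"
    by (cases "us = []") (simp_all add: linear_add[OF assms] linear_scale[OF assms])
qed

lemma altern_single: "altern (\<lambda>us. if length us = 1 then l (hd us) else 0)"
  by (simp add: altern_def)

context prolongation_chart
begin

lemma fun_form_wedge: "p \<in> W \<Longrightarrow> (fun_form W f \<^bold>\<and> \<eta>) p vs = f p * \<eta> p vs"
  using wl_scalar[of "f p" "\<eta> p" vs] by (simp add: wedge_wl fun_form_def[abs_def])

text \<open>Makes the graded Leibniz rule available for multiplication by a function, with
  \<open>q = 0\<close> and hence sign +1.\<close>

lemma fun_form_degree_0:
  assumes "smooth_on W f"
  shows "fun_form W f \<in> forms_of_degree 0 \<rho> W"
proof -
  have t: "triv_form (fun_form W f) p = (\<lambda>us. if us = [] then f p else 0)" if "p \<in> W" for p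
    using that by (auto simp: tr_fun_form)
  have "smooth_on W (\<lambda>p. triv_form (fun_form W f) p cs)" for cs
  proof (rule smooth_cong[OF W_open, of "\<lambda>p. if cs = [] then f p else 0"])
    show "smooth_on W (\<lambda>p. if cs = [] then f p else 0)"
      using assms smooth_const[OF W_open] by (cases "cs = []") simp_all
  qed (simp add: tr_fun_form)
  then have "fun_form W f \<in> forms \<rho> W"
    by (simp add: forms_tr normal_coframes t multilin_def altern_def)
  then show ?thesis by (auto simp: forms_of_degree_def fun_form_def)
qed

lemma tr_one_form:
  assumes "p \<in> W"
  shows "triv_form (one_form \<rho> W \<theta> \<phi>) p us =
    (if length us = 1 then (\<Sum>\<alpha>\<in>UNIV. \<theta> \<alpha> p * fst (hd us) $ \<alpha>) + (\<Sum>\<mu>\<in>UNIV. \<phi> \<mu> p * snd (hd us) $ \<mu>)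
     else 0)"
  using tr_coframe_e[OF assms, of _ us] tr_coframe_E[OF assms, of _ us]
  by (simp add: triv_form_def one_form_def)

lemma one_form_forms:
  assumes "\<And>\<alpha>. smooth_on W (\<theta> \<alpha>)" "\<And>\<mu>. smooth_on W (\<phi> \<mu>)"
  shows "one_form \<rho> W \<theta> \<phi> \<in> forms \<rho> W"
proof -
  let ?l = "\<lambda>p c. (\<Sum>\<alpha>\<in>UNIV. \<theta> \<alpha> p * fst c $ \<alpha>) + (\<Sum>\<mu>\<in>UNIV. \<phi> \<mu> p * snd c $ \<mu>)"
  have l: "linear (?l p)" for p
    by (rule linearI) (simp_all add: algebra_simps sum.distrib sum_distrib_left)
  have t: "triv_form (one_form \<rho> W \<theta> \<phi>) p = (\<lambda>us. if length us = 1 then ?l p (hd us) else 0)"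
    if "p \<in> W" for p
    using that by (intro ext) (simp only: tr_one_form)
  have m: "\<forall>p\<in>W. multilin (triv_form (one_form \<rho> W \<theta> \<phi>) p) \<and> altern (triv_form (one_form \<rho> W \<theta> \<phi>) p)"
  proof (intro ballI)
    fix p assume "p \<in> W"
    then show "multilin (triv_form (one_form \<rho> W \<theta> \<phi>) p) \<and> altern (triv_form (one_form \<rho> W \<theta> \<phi>) p)"
      unfolding t[OF \<open>p \<in> W\<close>] by (intro conjI multilin_single altern_single l)
  qed
  have "smooth_on W (\<lambda>p. triv_form (one_form \<rho> W \<theta> \<phi>) p cs)" for cs
  proof (rule smooth_cong[OF W_open, of "\<lambda>p. if length cs = 1 then ?l p (hd cs) else 0"])
    have "smooth_on W (\<lambda>p. ?l p (hd cs))"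
      by (intro smooth_add smooth_sum smooth_mult smooth_const W_open assms)
    then show "smooth_on W (\<lambda>p. if length cs = 1 then ?l p (hd cs) else 0)"
      using smooth_const[OF W_open] by (cases "length cs = 1") simp_all
  qed (simp add: tr_one_form)
  with m show ?thesis by (simp add: forms_tr normal_one_form)
qed

text \<open>A dual basis element is a one-form with Kronecker delta coefficients, so it is covered
  by \<open>one_form_forms\<close>.\<close>

lemma coframe_e_forms: "coframe_e \<rho> W \<alpha> \<in> forms \<rho> W"
proof -
  have "coframe_e \<rho> W \<alpha> = one_form \<rho> W (\<lambda>\<beta> p. if \<beta> = \<alpha> then 1 else 0) (\<lambda>\<mu> p. 0)"
    by (intro ext) (simp add: one_form_def if_distrib[of "\<lambda>c. c * _"] cong: if_cong)
  then show ?thesis by (simp add: one_form_forms smooth_const W_open)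
qed

lemma coframe_E_forms: "coframe_E \<rho> W \<mu> \<in> forms \<rho> W"
proof -
  have "coframe_E \<rho> W \<mu> = one_form \<rho> W (\<lambda>\<alpha> p. 0) (\<lambda>\<nu> p. if \<nu> = \<mu> then 1 else 0)"
    by (intro ext) (simp add: one_form_def if_distrib[of "\<lambda>c. c * _"] cong: if_cong)
  then show ?thesis by (simp add: one_form_forms smooth_const W_open)
qed

lemma forms_lin:
  assumes "\<omega> \<in> forms \<rho> W" "\<eta> \<in> forms \<rho> W"
  shows "(\<lambda>p vs. c * \<omega> p vs + \<eta> p vs) \<in> forms \<rho> W"
proof -
  have t: "triv_form (\<lambda>p vs. c * \<omega> p vs + \<eta> p vs) p = (\<lambda>us. c * triv_form \<omega> p us + triv_form \<eta> p us)" for p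
    by (auto simp: triv_form_def)
  have "smooth_on W (\<lambda>p. c * triv_form \<omega> p cs + triv_form \<eta> p cs)" for cs
    using assms by (intro smooth_add smooth_mult smooth_const W_open) (simp_all add: forms_tr)
  then show ?thesis
    using assms normal_lin[of \<omega> \<eta> "\<lambda>_. c"]
    by (simp add: forms_tr t multilin_def altern_def distrib_left)
qed

lemma zero_form: "(\<lambda>p vs. 0) \<in> forms \<rho> W"
  by (simp add: forms_tr normalized_def triv_form_def multilin_def altern_def smooth_const W_open)

text \<open>Over \<open>W\<close> the wedge with a function is pointwise multiplication, so the
  alternating and multilinear laws pass over from \<eta> directly, without any argument about
  shuffles.\<close>

lemma fun_form_wedge_forms:
  assumes f: "smooth_on W f" and \<eta>: "\<eta> \<in> forms \<rho> W"
  shows "fun_form W f \<^bold>\<and> \<eta> \<in> forms \<rho> W"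
proof -
  have t: "triv_form (fun_form W f \<^bold>\<and> \<eta>) p = (\<lambda>us. f p * triv_form \<eta> p us)" if "p \<in> W" for p
    using that by (auto simp: triv_form_def fun_form_wedge)
  have "smooth_on W (\<lambda>p. triv_form (fun_form W f \<^bold>\<and> \<eta>) p cs)" for cs
    by (rule smooth_cong[OF W_open, of "\<lambda>p. f p * triv_form \<eta> p cs"])
      (use \<eta> f in \<open>auto simp: t forms_tr intro: smooth_mult W_open\<close>)
  then show ?thesis
    using \<eta> normal_wedge[OF normal_coframes(3) forms_normal[OF \<eta>]]
    by (simp add: forms_tr t multilin_def altern_def algebra_simps)
qed

section \<open>Uniqueness of the exterior derivative on one-forms\<close>

lemma one_form_eq_wedges:
  "one_form \<rho> W \<theta> \<phi> = (\<lambda>p vs. (\<Sum>\<alpha>\<in>UNIV. (fun_form W (\<theta> \<alpha>) \<^bold>\<and> coframe_e \<rho> W \<alpha>) p vs) +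
     (\<Sum>\<mu>\<in>UNIV. (fun_form W (\<phi> \<mu>) \<^bold>\<and> coframe_E \<rho> W \<mu>) p vs))"
proof (intro ext)
  fix p :: "(real^'m) \<times> (real^'r)" and vs :: "('a, 'm, 'r) pvec list"
  show "one_form \<rho> W \<theta> \<phi> p vs = (\<Sum>\<alpha>\<in>UNIV. (fun_form W (\<theta> \<alpha>) \<^bold>\<and> coframe_e \<rho> W \<alpha>) p vs) +
     (\<Sum>\<mu>\<in>UNIV. (fun_form W (\<phi> \<mu>) \<^bold>\<and> coframe_E \<rho> W \<mu>) p vs)"
  proof (cases "p \<in> W")
    \<comment> \<open>Off \<open>W\<close> both sides vanish by the convention for default values;
      \<open>fun_form_wedge\<close> speaks only of points of \<open>W\<close>.\<close>
    case False
    then show ?thesis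
      by (simp add: one_form_def wedge_def fun_form_def coframe_e_def coframe_E_def)
  qed (simp add: one_form_def fun_form_wedge)
qed

text \<open>The value on a function is prescribed, and the Leibniz rule expresses the value on the
  product through it and the value on \<eta>; \<delta> and \<open>ext_d\<close> obey the same two
  rules.\<close>

lemma ext_d_unique_fun_form_wedge:
  assumes \<delta>: "exterior_derivative U \<rho> br W \<delta>" and f: "smooth_on W f" and \<eta>: "\<eta> \<in> forms \<rho> W"
    and eq: "\<delta> \<eta> = ext_d \<eta>"
  shows "\<delta> (fun_form W f \<^bold>\<and> \<eta>) = ext_d (fun_form W f \<^bold>\<and> \<eta>)"
proof -
  have "\<delta> (fun_form W f) = ext_d (fun_form W f)"
    using \<delta> f unfolding exterior_derivative_def ext_d_fun[OF f] by blast
  moreover have "\<delta> (fun_form W f \<^bold>\<and> \<eta>) =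
      (\<lambda>p vs. (\<delta> (fun_form W f) \<^bold>\<and> \<eta>) p vs + (- 1) ^ 0 * (fun_form W f \<^bold>\<and> \<delta> \<eta>) p vs)"
    using \<delta> fun_form_degree_0[OF f] \<eta> unfolding exterior_derivative_def by blast
  ultimately show ?thesis
    by (simp only: eq ext_d_leibniz[OF fun_form_degree_0[OF f] \<eta>])
qed

lemma ext_d_unique_lin:
  assumes \<delta>: "exterior_derivative U \<rho> br W \<delta>"
    and "\<omega> \<in> forms \<rho> W" "\<eta> \<in> forms \<rho> W" "\<delta> \<omega> = ext_d \<omega>" "\<delta> \<eta> = ext_d \<eta>"
  shows "\<delta> (\<lambda>p vs. c * \<omega> p vs + \<eta> p vs) = ext_d (\<lambda>p vs. c * \<omega> p vs + \<eta> p vs)"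
proof -
  have "\<delta> (\<lambda>p vs. c * \<omega> p vs + \<eta> p vs) = (\<lambda>p vs. c * \<delta> \<omega> p vs + \<delta> \<eta> p vs)"
    using assms(1-3) unfolding exterior_derivative_def by blast
  then show ?thesis by (simp only: assms(4,5) ext_d_lin[OF assms(2,3)])
qed

lemma ext_d_unique_sum:
  assumes \<delta>: "exterior_derivative U \<rho> br W \<delta>" and "finite I"
    and "\<And>i. i \<in> I \<Longrightarrow> \<omega> i \<in> forms \<rho> W \<and> \<delta> (\<omega> i) = ext_d (\<omega> i)"
  shows "(\<lambda>p vs. \<Sum>i\<in>I. \<omega> i p vs) \<in> forms \<rho> W \<and>
    \<delta> (\<lambda>p vs. \<Sum>i\<in>I. \<omega> i p vs) = ext_d (\<lambda>p vs. \<Sum>i\<in>I. \<omega> i p vs)"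
  using assms(2,3)
proof (induction I)
  case empty
  have "\<delta> (\<lambda>p vs. c * \<omega> p vs + \<eta> p vs) = (\<lambda>p vs. c * \<delta> \<omega> p vs + \<delta> \<eta> p vs)"
    if "\<omega> \<in> forms \<rho> W" "\<eta> \<in> forms \<rho> W" for c \<omega> \<eta>
    using \<delta> that unfolding exterior_derivative_def by blast
  \<comment> \<open>Linearity with \<open>c = - 1\<close> on two zero forms gives
    \<open>\<delta> 0 = - \<delta> 0 + \<delta> 0 = 0\<close>, and likewise for
    \<open>ext_d\<close>.\<close>
  from this[OF zero_form zero_form, of "- 1"] ext_d_lin[OF zero_form zero_form, of "- 1"]
  show ?case by (simp add: zero_form)
next
  case (insert i I)
  then have *: "\<omega> i \<in> forms \<rho> W" "\<delta> (\<omega> i) = ext_d (\<omega> i)" "(\<lambda>p vs. \<Sum>i\<in>I. \<omega> i p vs) \<in> forms \<rho> W"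
    "\<delta> (\<lambda>p vs. \<Sum>i\<in>I. \<omega> i p vs) = ext_d (\<lambda>p vs. \<Sum>i\<in>I. \<omega> i p vs)" by auto
  show ?case
    using forms_lin[OF *(1,3), of 1] ext_d_unique_lin[OF \<delta> *(1,3,2,4), of 1] insert.hyps
    by simp
qed

text \<open>\<delta> is known only through its determining properties, while \<open>ext_d\<close>
  has an explicit formula. A one-form is a sum of functions times dual basis elements, on which the
  two agree, so \<delta> may be computed by that formula.\<close>

theorem ext_d_unique_one_form:
  assumes \<delta>: "exterior_derivative U \<rho> br W \<delta>"
    and s: "\<And>\<alpha>. smooth_on W (\<theta> \<alpha>)" "\<And>\<mu>. smooth_on W (\<phi> \<mu>)"
  shows "\<delta> (one_form \<rho> W \<theta> \<phi>) = ext_d (one_form \<rho> W \<theta> \<phi>)"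
proof -
  have e: "\<delta> (coframe_e \<rho> W \<alpha>) = ext_d (coframe_e \<rho> W \<alpha>)" for \<alpha>
    using \<delta> unfolding exterior_derivative_def ext_d_coframe_e by blast
  have E: "\<delta> (coframe_E \<rho> W \<mu>) = ext_d (coframe_E \<rho> W \<mu>)" for \<mu>
    using \<delta> unfolding exterior_derivative_def ext_d_coframe_E by blast
  let ?A = "\<lambda>p vs. \<Sum>\<alpha>\<in>UNIV. (fun_form W (\<theta> \<alpha>) \<^bold>\<and> coframe_e \<rho> W \<alpha>) p vs"
  let ?B = "\<lambda>p vs. \<Sum>\<mu>\<in>UNIV. (fun_form W (\<phi> \<mu>) \<^bold>\<and> coframe_E \<rho> W \<mu>) p vs"
  have A: "?A \<in> forms \<rho> W \<and> \<delta> ?A = ext_d ?A"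
    using s e by (intro ext_d_unique_sum[OF \<delta>])
      (simp_all add: fun_form_wedge_forms ext_d_unique_fun_form_wedge[OF \<delta>] coframe_e_forms)
  have B: "?B \<in> forms \<rho> W \<and> \<delta> ?B = ext_d ?B"
    using s E by (intro ext_d_unique_sum[OF \<delta>])
      (simp_all add: fun_form_wedge_forms ext_d_unique_fun_form_wedge[OF \<delta>] coframe_E_forms)
  show ?thesis
    using ext_d_unique_lin[OF \<delta>, of ?A ?B 1] A B by (simp add: one_form_eq_wedges)
qed

section \<open>The ingredients of Cartan's formula in the local basis\<close>

lemma fd_tr_one_form:
  assumes p: "p \<in> W" and s: "\<And>\<alpha>. smooth_on W (\<theta> \<alpha>)" "\<And>\<mu>. smooth_on W (\<phi> \<mu>)"
  shows "frechet_derivative (\<lambda>q. triv_form (one_form \<rho> W \<theta> \<phi>) q [c]) (at p) v =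
    (\<Sum>\<alpha>\<in>UNIV. frechet_derivative (\<theta> \<alpha>) (at p) v * fst c $ \<alpha>) +
    (\<Sum>\<mu>\<in>UNIV. frechet_derivative (\<phi> \<mu>) (at p) v * snd c $ \<mu>)"
proof -
  have d: "(\<theta> \<alpha> has_derivative frechet_derivative (\<theta> \<alpha>) (at p)) (at p)"
    "(\<phi> \<mu> has_derivative frechet_derivative (\<phi> \<mu>) (at p)) (at p)" for \<alpha> \<mu>
    using smooth_differentiable[OF s(1) p] smooth_differentiable[OF s(2) p]
    by (auto simp: frechet_derivative_works)
  \<comment> \<open>The argument \<open>c\<close> has constant coefficients, so only the coefficient
    functions of the form are differentiated.\<close>
  have "((\<lambda>q. (\<Sum>\<alpha>\<in>UNIV. \<theta> \<alpha> q * fst c $ \<alpha>) + (\<Sum>\<mu>\<in>UNIV. \<phi> \<mu> q * snd c $ \<mu>)) has_derivative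
      (\<lambda>v. (\<Sum>\<alpha>\<in>UNIV. frechet_derivative (\<theta> \<alpha>) (at p) v * fst c $ \<alpha>) +
        (\<Sum>\<mu>\<in>UNIV. frechet_derivative (\<phi> \<mu>) (at p) v * snd c $ \<mu>))) (at p)"
    by (intro has_derivative_add has_derivative_sum has_derivative_mult_left d)
  moreover have "frechet_derivative (\<lambda>q. triv_form (one_form \<rho> W \<theta> \<phi>) q [c]) (at p) =
     frechet_derivative (\<lambda>q. (\<Sum>\<alpha>\<in>UNIV. \<theta> \<alpha> q * fst c $ \<alpha>) + (\<Sum>\<mu>\<in>UNIV. \<phi> \<mu> q * snd c $ \<mu>)) (at p)"
    by (rule fd_W_cong[OF p]) (simp add: tr_one_form)
  ultimately show ?thesis by (simp add: fd_eq)
qed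

text \<open>The anchor splits into a horizontal part, given by \<rho>, and the vertical part
  \<open>w\<close>. With the derivatives \<open>X_\<alpha>(ybar)\<close> as \<open>w\<close>, at a
  point of the graph, the result is \<open>Y_\<alpha>\<close>.\<close>

lemma fd_anchor_at:
  fixes f :: "(real^'m) \<times> (real^'r) \<Rightarrow> real"
  assumes p: "p \<in> W" and f: "smooth_on W f"
  shows "frechet_derivative f (at p) (anchor_at p (axis \<alpha> 1, w)) =
    (\<Sum>i\<in>UNIV. anchor_coeff \<rho> i \<alpha> (fst p) * partial_x i f p) + (\<Sum>\<nu>\<in>UNIV. w $ \<nu> * partial_y \<nu> f p)"
proof -
  have d: "f differentiable (at p)" by (rule smooth_differentiable[OF f p])
  show ?thesis
    by (simp only: anchor_at_def fst_conv snd_conv fd_expand[OF d, of "\<rho> (fst p) (axis \<alpha> 1)"]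
        fd_expand_y[OF d, of w] partial_x_def partial_y_def anchor_coeff_def)
qed

text \<open>The vertical parts \<open>w\<close> and \<open>w'\<close> drop out because the sections
  \<open>E_\<mu>\<close> have zero brackets with all basis sections.\<close>

lemma structure_at_basis:
  "structure_at p \<gamma> (axis \<alpha> 1, w) (axis \<beta> 1, w') = bracket_coeff U br \<gamma> \<alpha> \<beta> (fst p)"
proof -
  have "structure_at p \<gamma> (axis \<alpha> 1, w) (axis \<beta> 1, w') = (\<Sum>\<alpha>'\<in>UNIV. \<Sum>\<beta>'\<in>UNIV.
      if \<beta>' = \<beta> then if \<alpha>' = \<alpha> then bracket_coeff U br \<gamma> \<alpha>' \<beta>' (fst p) else 0 else 0)"
    unfolding structure_at_def by (intro sum.cong refl) (auto simp: axis_def)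
  then show ?thesis by simp
qed

end

lemma sum_axis: "(\<Sum>\<beta>\<in>UNIV. f \<beta> * axis \<alpha> (1::real) $ \<beta>) = f (\<alpha> :: 'n::finite)"
proof -
  have "(\<Sum>\<beta>\<in>UNIV. f \<beta> * axis \<alpha> (1::real) $ \<beta>) = (\<Sum>\<beta>\<in>UNIV. if \<beta> = \<alpha> then f \<beta> else 0)"
    by (intro sum.cong refl) (auto simp: axis_def)
  then show ?thesis by simp
qed

section \<open>Evaluation along the graph of a solution\<close>

theorem proposition4:
  fixes U :: "(real^'m) set"
    and \<rho> :: "real^'m \<Rightarrow> real^'a \<Rightarrow> real^'m"
    and br :: "(real^'m \<Rightarrow> real^'a) \<Rightarrow> (real^'m \<Rightarrow> real^'a) \<Rightarrow> (real^'m \<Rightarrow> real^'a)"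
    and W :: "((real^'m) \<times> (real^'r)) set"
    and \<delta> :: "('a, 'm, 'r) form \<Rightarrow> ('a, 'm, 'r) form"
    and n :: nat
    and \<theta> :: "nat \<Rightarrow> 'a \<Rightarrow> (real^'m) \<times> (real^'r) \<Rightarrow> real"
    and varpi :: "nat \<Rightarrow> 'r \<Rightarrow> (real^'m) \<times> (real^'r) \<Rightarrow> real"
    and V :: "(real^'m) set"
    and ybar :: "real^'m \<Rightarrow> real^'r"
  assumes "lie_algebroid U \<rho> br"
    and "open W" and "fst ` W = U"
    and "exterior_derivative U \<rho> br W \<delta>"
    and "\<And>k \<alpha>. k \<in> {1..n} \<Longrightarrow> smooth_on W (\<theta> k \<alpha>)"
    and "\<And>k \<mu>. k \<in> {1..n} \<Longrightarrow> smooth_on W (varpi k \<mu>)"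
    and "differential_ideal \<delta> (algebraic_ideal \<rho> W n (\<lambda>k. one_form \<rho> W (\<theta> k) (varpi k)))"
    and "is_solution \<rho> W n \<theta> varpi V ybar"
  shows "\<forall>k\<in>{1..n}. \<forall>\<alpha> \<beta>. \<forall>x\<in>V.
    0 = - Y_field \<rho> ybar \<alpha> (\<theta> k \<beta>) x
        - (\<Sum>\<mu>\<in>UNIV. X_field \<rho> \<beta> (\<lambda>x'. ybar x' $ \<mu>) x * Y_field \<rho> ybar \<alpha> (varpi k \<mu>) x)
        + Y_field \<rho> ybar \<beta> (\<theta> k \<alpha>) x
        + (\<Sum>\<mu>\<in>UNIV. X_field \<rho> \<alpha> (\<lambda>x'. ybar x' $ \<mu>) x * Y_field \<rho> ybar \<beta> (varpi k \<mu>) x)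
        + (\<Sum>\<gamma>\<in>UNIV. bracket_coeff U br \<gamma> \<alpha> \<beta> x * \<theta> k \<gamma> (x, ybar x))"
proof (intro ballI allI)
  fix k \<alpha> \<beta> x assume k: "k \<in> {1..n}" and x: "x \<in> V"
  interpret prolongation_chart U \<rho> br W
    using assms(1-3) by (simp add: prolongation_chart_def prolongation_chart_axioms_def)
  define \<sigma> where "\<sigma> = (\<lambda>k. one_form \<rho> W (\<theta> k) (varpi k))"
  define I where "I = algebraic_ideal \<rho> W n \<sigma>"
  define p where "p = (x, ybar x)"
  \<comment> \<open>The derivatives of \<open>ybar\<close> are frozen at \<open>x\<close>, so
    \<open>c \<alpha>\<close> stands for a section with constant coefficients. Cartan's formula then
    differentiates only the coefficients of the form, and no second derivative of
    \<open>ybar\<close> appears.\<close>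
  define w where "w = (\<lambda>\<alpha>. (\<chi> \<mu>. X_field \<rho> \<alpha> (\<lambda>x'. ybar x' $ \<mu>) x) :: real^'r)"
  define c where "c = (\<lambda>\<alpha>. (axis \<alpha> 1 :: real^'a, w \<alpha>))"
  have p: "p \<in> W" using assms(8) x by (simp add: is_solution_def p_def)
  have s: "\<And>\<alpha>. smooth_on W (\<theta> k \<alpha>)" "\<And>\<mu>. smooth_on W (varpi k \<mu>)" using assms(5,6) k by auto

  have \<sigma>1: "triv_form (\<sigma> j) p [c \<alpha>] = 0" if "j \<in> {1..n}" for j \<alpha>
  proof -
    \<comment> \<open>This is the system of PDEs at \<open>x\<close>: its left-hand side is the
      value of the form on \<open>c \<alpha>\<close>.\<close>
    have "\<theta> j \<alpha> p + (\<Sum>\<mu>\<in>UNIV. w \<alpha> $ \<mu> * varpi j \<mu> p) = 0"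
      using assms(8) that x by (simp add: is_solution_def p_def w_def X_field_def)
    then show ?thesis by (simp add: \<sigma>_def tr_one_form p c_def sum_axis mult.commute)
  qed
  have \<sigma>_other: "triv_form (\<sigma> j) p us = 0" if "length us \<noteq> 1" for j us
    using that by (simp add: \<sigma>_def tr_one_form p)

  have "\<sigma> k \<in> I"
  proof -
    \<comment> \<open>The ideal consists of sums of wedge products, so the generator is exhibited as
      one: coefficient the constant function 1 at index \<open>k\<close>, the zero form
      elsewhere.\<close>
    let ?a = "\<lambda>j. if j = k then fun_form W (\<lambda>p. 1) else (\<lambda>p vs. 0)"
    have "(?a j \<^bold>\<and> \<sigma> j) q vs = (if j = k then \<sigma> k q vs else 0)" for j q vs
    proof (cases "j = k \<and> q \<in> W")
      case True then show ?thesis by (simp add: fun_form_wedge)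
    next
      case False
      then show ?thesis
        by (auto simp: wedge_def fun_form_def \<sigma>_def one_form_def coframe_e_def coframe_E_def)
    qed
    then have "\<sigma> k = (\<lambda>q vs. \<Sum>j = 1..n. (?a j \<^bold>\<and> \<sigma> j) q vs)"
      using k by (intro ext) simp
    moreover have "?a j \<in> forms \<rho> W" for j
      using fun_form_degree_0[OF smooth_const[OF W_open, of 1]] zero_form
      by (simp add: forms_of_degree_def)
    ultimately show ?thesis unfolding I_def algebraic_ideal_def
      by (intro CollectI exI[of _ ?a] conjI ballI)
  qed
  then have "\<delta> (\<sigma> k) \<in> I" using assms(7) by (simp add: differential_ideal_def I_def \<sigma>_def)
  then obtain a where a: "\<delta> (\<sigma> k) = (\<lambda>q vs. \<Sum>j = 1..n. (a j \<^bold>\<and> \<sigma> j) q vs)"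
    unfolding I_def algebraic_ideal_def by blast
  have "triv_form (\<delta> (\<sigma> k)) p [c \<alpha>, c \<beta>] =
      (\<Sum>j = 1..n. list_wedge (triv_form (a j) p) (triv_form (\<sigma> j) p) [c \<alpha>, c \<beta>])"
    unfolding tr_wedge[symmetric] by (simp add: a triv_form_def)
  \<comment> \<open>Each wedge expands into four shuffle terms. Two contain the value of
    \<open>\<sigma> j\<close> on one of the vectors \<open>c \<alpha>\<close>,
    \<open>c \<beta>\<close>; the other two contain its value on a list of length 0 or 2. All
    vanish, even if \<open>a j\<close> has mixed degree.\<close>
  also have "\<dots> = 0"
    by (intro sum.neutral ballI) (simp add: \<sigma>1 \<sigma>_other)
  finally have "triv_form (ext_d (\<sigma> k)) p [c \<alpha>, c \<beta>] = 0"
    using ext_d_unique_one_form[OF assms(4) s] by (simp add: \<sigma>_def)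
  \<comment> \<open>Unfolding the recursion for \<open>ext_d\<close> on two arguments leaves the two
    derivative terms and the bracket of the two arguments in the remaining slot.\<close>
  then have 0: "frechet_derivative (\<lambda>q. triv_form (\<sigma> k) q [c \<beta>]) (at p) (anchor_at p (c \<alpha>))
      - (\<Sum>\<gamma>\<in>UNIV. structure_at p \<gamma> (c \<alpha>) (c \<beta>) * triv_form (\<sigma> k) p [(axis \<gamma> 1, 0)])
      - frechet_derivative (\<lambda>q. triv_form (\<sigma> k) q [c \<alpha>]) (at p) (anchor_at p (c \<beta>)) = 0"
    by (simp add: tr_ext_d p triv_lie_def)
  have Y: "frechet_derivative f (at p) (anchor_at p (c \<alpha>)) = Y_field \<rho> ybar \<alpha> f x"
    if "smooth_on W f" for f \<alpha>
    by (simp add: c_def fd_anchor_at[OF p that]) (simp add: Y_field_def w_def p_def)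
  have D: "frechet_derivative (\<lambda>q. triv_form (\<sigma> k) q [c \<beta>]) (at p) (anchor_at p (c \<alpha>)) =
      Y_field \<rho> ybar \<alpha> (\<theta> k \<beta>) x +
      (\<Sum>\<mu>\<in>UNIV. X_field \<rho> \<beta> (\<lambda>x'. ybar x' $ \<mu>) x * Y_field \<rho> ybar \<alpha> (varpi k \<mu>) x)" for \<alpha> \<beta>
  proof -
    have "frechet_derivative (\<lambda>q. triv_form (\<sigma> k) q [c \<beta>]) (at p) (anchor_at p (c \<alpha>)) =
      (\<Sum>\<gamma>\<in>UNIV. Y_field \<rho> ybar \<alpha> (\<theta> k \<gamma>) x * fst (c \<beta>) $ \<gamma>) +
      (\<Sum>\<mu>\<in>UNIV. Y_field \<rho> ybar \<alpha> (varpi k \<mu>) x * snd (c \<beta>) $ \<mu>)"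
      by (simp only: \<sigma>_def fd_tr_one_form[OF p s] Y s)
    then show ?thesis by (simp add: c_def sum_axis w_def) (simp add: mult.commute)
  qed
  \<comment> \<open>The pair \<open>(axis \<gamma> 1, 0)\<close> represents
    \<open>e_\<gamma>\<close>, on which the form takes the value of its coefficient
    \<open>\<theta> k \<gamma>\<close>.\<close>
  have L: "structure_at p \<gamma> (c \<alpha>) (c \<beta>) * triv_form (\<sigma> k) p [(axis \<gamma> 1, 0)] =
      bracket_coeff U br \<gamma> \<alpha> \<beta> x * \<theta> k \<gamma> (x, ybar x)" for \<gamma>
    by (simp add: c_def structure_at_basis \<sigma>_def tr_one_form p sum_axis) (simp add: p_def)
  show "0 = - Y_field \<rho> ybar \<alpha> (\<theta> k \<beta>) x
        - (\<Sum>\<mu>\<in>UNIV. X_field \<rho> \<beta> (\<lambda>x'. ybar x' $ \<mu>) x * Y_field \<rho> ybar \<alpha> (varpi k \<mu>) x)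
        + Y_field \<rho> ybar \<beta> (\<theta> k \<alpha>) x
        + (\<Sum>\<mu>\<in>UNIV. X_field \<rho> \<alpha> (\<lambda>x'. ybar x' $ \<mu>) x * Y_field \<rho> ybar \<beta> (varpi k \<mu>) x)
        + (\<Sum>\<gamma>\<in>UNIV. bracket_coeff U br \<gamma> \<alpha> \<beta> x * \<theta> k \<gamma> (x, ybar x))"
    \<comment> \<open>After rewriting, \<open>0\<close> is the negative of the dependency
      condition.\<close>
    using 0 unfolding D L by linarith
qed

end
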